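(* Assume: (A1) For all $\tilde z,\tilde\theta\in\mathcal A$, the functional $\tilde a\mapsto U(\tilde a,\tilde z,\tilde\theta)$ is continuously Gâteaux differentiable and strongly concave with constant $\alpha_U>0$, i.e. $U(\tilde a,\tilde z,\tilde\theta)+\frac{\alpha_U}{2}\|\tilde a\|_{\mathcal A}^2$ is concave in $\tilde a$; moreover $\nabla_{\tilde a}U(\cdot,\tilde z,\tilde\theta)$ is Lipschitz continuous in $\tilde z,\tilde\theta$ with constants $\ell_U,\ell_\theta$, i.e. $\|\nabla_{\tilde a}U(\tilde a,\tilde z_1,\tilde\theta_1)-\nabla_{\tilde a}U(\tilde a,\tilde z_2,\tilde\theta_2)\|_{\mathcal A}\le \ell_U\|\tilde z_1-\tilde z_2\|_{\mathcal A}+\ell_\theta\|\tilde\theta_1-\tilde\theta_2\|_{\mathcal A}$ for all $\tilde a,\tilde z_i,\tilde\theta_i\in\mathcal A$. (A2) For each $i\in\{1,\dots,N\}$ the set of admissible actions $\mathcal A^{i,N}\subset\mathcal A$ is nonempty, convex and closed. Then: (i) Fix a graph with symmetric adjacency matrix $G^N\in[0,1]^{N\times N}$, with largest eigenvalue $\lambda_1(G^N)$. If $\ell_U\cdot\lambda_1(G^N)<\alpha_U\cdot N$, the network game $\mathcal G(\mathcal A_{ad}^N,U,\theta^N,G^N)$ admits a unique Nash equilibrium. (ii) Consequently, if $\ell_U<\alpha_U$, the network game $\mathcal G(\mathcal A_{ad}^N,U,\theta^N,G^N)$ admits a unique Nash equilibrium for every graph with symmetric adjacency matrix $G^N\in[0,1]^{N\times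 N}$.
   Context: Fix $T>0$, $N\in\mathbb N$, and a filtered probability space $(\Omega,\mathcal F,\mathbb F=(\mathcal F_t)_{0\le t\le T},\mathbb P)$ satisfying the usual conditions. $\mathcal A$ is the Hilbert space of $\mathbb F$-progressively measurable $\tilde a:\Omega\times[0,T]\to\mathbb R$ with $\|\tilde a\|_{\mathcal A}^2=\int_0^T\mathbb E[\tilde a_t^2]dt<\infty$, with inner product $\langle\tilde a,\tilde b\rangle_{\mathcal A}=\mathbb E[\int_0^T\tilde a_t\tilde b_tdt]$. $U:\mathcal A\times\mathcal A\times\mathcal A\to\mathbb R$ is a given utility functional and $\theta^N=(\theta^{1,N},\dots,\theta^{N,N})\in\mathcal A^N$ a vector of heterogeneity processes. Network game $\mathcal G(\mathcal A_{ad}^N,U,\theta^N,G^N)$: player $i\in\{1,\dots,N\}$ chooses an action in $\mathcal A^{i,N}\subset\mathcal A$; $\mathcal A_{ad}^N=\prod_{i=1}^N\mathcal A^{i,N}$. For $a^N\in\mathcal A_{ad}^N$ the local aggregate is $z^{i,N}(a^N)=\frac1N\sum_{j=1}^NG^N_{ij}a^{j,N}$. A Nash equilibrium is a vector $\bar a^N\in\mathcal A_{ad}^N$ such that for every $i$, $\bar a^{i,N}=\arg\max_{\tilde a\in\mathcal A^{i,N}}U(\tilde a,z^{i,N}(\bar a^N),\theta^{i,N})$. *)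

theory Defs
  imports "HOL-Probability.Probability"
begin

text \<open>
  Processes are total functions of a state and a real time; only their values on
  \<open>space M \<times> {0..T}\<close> are relevant. The time index set of the filtration is \<open>{0..T}\<close>: nothing is
  required of \<open>F t\<close> for other \<open>t\<close>, and only the sigma-algebra (not the measure) carried by \<open>F t\<close>
  is used.
\<close>

type_synonym 'w process = "'w \<Rightarrow> real \<Rightarrow> real"

locale filtered_prob_space = prob_space M + complete_measure M
  for M :: "'w measure" +
  fixes F :: "real \<Rightarrow> 'w measure" and T :: real
  assumes horizon_pos: "0 < T"
    and subalgebras: "\<And>t. t \<in> {0..T} \<Longrightarrow> subalgebra M (F t)"
    and filtration_mono: "\<And>s t. 0 \<le> s \<Longrightarrow> s \<le> t \<Longrightarrow> t \<le> T \<Longrightarrow> sets (F s) \<subseteq> sets (F t)"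
    and null_sets_initial: "null_sets M \<subseteq> sets (F 0)"
    and right_continuous: "\<And>t. t \<in> {0..<T} \<Longrightarrow> sets (F t) = (\<Inter>u\<in>{t<..T}. sets (F u))"

definition progressively_measurable ::
    "(real \<Rightarrow> 'w measure) \<Rightarrow> real \<Rightarrow> 'w process \<Rightarrow> bool" where
  "progressively_measurable F T a \<longleftrightarrow>
     (\<forall>t\<in>{0..T}. (\<lambda>(w, s). a w s) \<in> borel_measurable (F t \<Otimes>\<^sub>M restrict_space borel {0..t}))"

text \<open>
  The elements of \<open>\<A>\<close> are represented by processes. Two processes represent the same
  element iff they are related by \<open>proc_eq\<close> (equality almost everywhere for the product of
  \<open>M\<close> and Lebesgue measure).
\<close>

definition proc_space ::
    "'w measure \<Rightarrow> (real \<Rightarrow> 'w measure) \<Rightarrow> real \<Rightarrow> 'w process set" where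
  "proc_space M F T =
     {a. progressively_measurable F T a \<and>
         (\<integral>\<^sup>+ t. (\<integral>\<^sup>+ w. ennreal ((a w t)\<^sup>2) \<partial>M) * indicator {0..T} t \<partial>lborel) < \<infinity>}"

definition proc_eq :: "'w measure \<Rightarrow> real \<Rightarrow> 'w process \<Rightarrow> 'w process \<Rightarrow> bool" where
  "proc_eq M T a b \<longleftrightarrow>
     (AE x in M \<Otimes>\<^sub>M restrict_space lborel {0..T}. a (fst x) (snd x) = b (fst x) (snd x))"

definition proc_inner :: "'w measure \<Rightarrow> real \<Rightarrow> 'w process \<Rightarrow> 'w process \<Rightarrow> real" where
  "proc_inner M T a b = (LINT w|M. (LINT t:{0..T}|lborel. a w t * b w t))"

definition proc_norm :: "'w measure \<Rightarrow> real \<Rightarrow> 'w process \<Rightarrow> real" where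
  "proc_norm M T a = sqrt (LINT t:{0..T}|lborel. (LINT w|M. (a w t)\<^sup>2))"

definition proc_add :: "'w process \<Rightarrow> 'w process \<Rightarrow> 'w process" where
  "proc_add a b = (\<lambda>w t. a w t + b w t)"

definition proc_diff :: "'w process \<Rightarrow> 'w process \<Rightarrow> 'w process" where
  "proc_diff a b = (\<lambda>w t. a w t - b w t)"

definition proc_scale :: "real \<Rightarrow> 'w process \<Rightarrow> 'w process" where
  "proc_scale c a = (\<lambda>w t. c * a w t)"

definition proc_convex :: "'w process set \<Rightarrow> bool" where
  "proc_convex S \<longleftrightarrow>
     (\<forall>a\<in>S. \<forall>b\<in>S. \<forall>u\<in>{0..1}. proc_add (proc_scale (1 - u) a) (proc_scale u b) \<in> S)"

text \<open>
  Norm-closedness relative to \<open>proc_space\<close>. Constant sequences show that a closed set contains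
  with each process all other representatives (in \<open>proc_space\<close>) of the same element.
\<close>

definition proc_closed ::
    "'w measure \<Rightarrow> (real \<Rightarrow> 'w measure) \<Rightarrow> real \<Rightarrow> 'w process set \<Rightarrow> bool" where
  "proc_closed M F T S \<longleftrightarrow>
     (\<forall>a l. (\<forall>n::nat. a n \<in> S) \<longrightarrow> l \<in> proc_space M F T \<longrightarrow>
        (\<lambda>n. proc_norm M T (proc_diff (a n) l)) \<longlonglongrightarrow> 0 \<longrightarrow> l \<in> S)"

definition proc_concave ::
    "'w measure \<Rightarrow> (real \<Rightarrow> 'w measure) \<Rightarrow> real \<Rightarrow> ('w process \<Rightarrow> real) \<Rightarrow> bool" where
  "proc_concave M F T f \<longleftrightarrow>
     (\<forall>a\<in>proc_space M F T. \<forall>b\<in>proc_space M F T. \<forall>u\<in>{0..1}.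
        (1 - u) * f a + u * f b \<le> f (proc_add (proc_scale (1 - u) a) (proc_scale u b)))"

definition strongly_concave ::
    "'w measure \<Rightarrow> (real \<Rightarrow> 'w measure) \<Rightarrow> real \<Rightarrow> real \<Rightarrow> ('w process \<Rightarrow> real) \<Rightarrow> bool" where
  "strongly_concave M F T \<alpha> f \<longleftrightarrow>
     0 < \<alpha> \<and> proc_concave M F T (\<lambda>a. f a + \<alpha> / 2 * (proc_norm M T a)\<^sup>2)"

text \<open>
  The gradient is the Riesz representative of the (two-sided) directional derivative.
\<close>

definition has_gateaux_gradient ::
    "'w measure \<Rightarrow> (real \<Rightarrow> 'w measure) \<Rightarrow> real \<Rightarrow> ('w process \<Rightarrow> real) \<Rightarrow>
       'w process \<Rightarrow> 'w process \<Rightarrow> bool" where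
  "has_gateaux_gradient M F T f g a \<longleftrightarrow>
     g \<in> proc_space M F T \<and>
     (\<forall>h\<in>proc_space M F T.
        ((\<lambda>\<epsilon>. (f (proc_add a (proc_scale \<epsilon> h)) - f a) / \<epsilon>) \<longlongrightarrow> proc_inner M T g h) (at 0))"

text \<open>The gradient is unique up to \<open>proc_eq\<close>; the choice of representative is immaterial.\<close>

definition gateaux_gradient ::
    "'w measure \<Rightarrow> (real \<Rightarrow> 'w measure) \<Rightarrow> real \<Rightarrow> ('w process \<Rightarrow> real) \<Rightarrow>
       'w process \<Rightarrow> 'w process" where
  "gateaux_gradient M F T f a = (SOME g. has_gateaux_gradient M F T f g a)"

definition continuously_gateaux_differentiable ::
    "'w measure \<Rightarrow> (real \<Rightarrow> 'w measure) \<Rightarrow> real \<Rightarrow> ('w process \<Rightarrow> real) \<Rightarrow> bool" where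
  "continuously_gateaux_differentiable M F T f \<longleftrightarrow>
     (\<forall>a\<in>proc_space M F T. \<exists>g. has_gateaux_gradient M F T f g a) \<and>
     (\<forall>a\<in>proc_space M F T. \<forall>e>0. \<exists>d>0. \<forall>b\<in>proc_space M F T.
        proc_norm M T (proc_diff b a) < d \<longrightarrow>
        proc_norm M T (proc_diff (gateaux_gradient M F T f b) (gateaux_gradient M F T f a)) < e)"

text \<open>
  \<open>U\<close> is a functional on \<open>\<A> \<times> \<A> \<times> \<A>\<close>, i.e. it does not depend on the chosen representatives.
\<close>

definition utility_functional ::
    "'w measure \<Rightarrow> (real \<Rightarrow> 'w measure) \<Rightarrow> real \<Rightarrow>
       ('w process \<Rightarrow> 'w process \<Rightarrow> 'w process \<Rightarrow> real) \<Rightarrow> bool" where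
  "utility_functional M F T U \<longleftrightarrow>
     (\<forall>a\<in>proc_space M F T. \<forall>a'\<in>proc_space M F T. \<forall>z\<in>proc_space M F T. \<forall>z'\<in>proc_space M F T.
      \<forall>\<theta>\<in>proc_space M F T. \<forall>\<theta>'\<in>proc_space M F T.
        proc_eq M T a a' \<longrightarrow> proc_eq M T z z' \<longrightarrow> proc_eq M T \<theta> \<theta>' \<longrightarrow> U a z \<theta> = U a' z' \<theta>')"

text \<open>The players are the elements of the finite type \<open>'n\<close>, so that \<open>N = CARD('n)\<close>.\<close>

definition local_aggregate ::
    "real^'n^'n \<Rightarrow> ('n::finite \<Rightarrow> 'w process) \<Rightarrow> 'n \<Rightarrow> 'w process" where
  "local_aggregate G a i = (\<lambda>w t. 1 / real CARD('n) * (\<Sum>j\<in>UNIV. G $ i $ j * a j w t))"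

definition nash_equilibrium ::
    "('n::finite \<Rightarrow> 'w process set) \<Rightarrow> ('w process \<Rightarrow> 'w process \<Rightarrow> 'w process \<Rightarrow> real) \<Rightarrow>
       ('n \<Rightarrow> 'w process) \<Rightarrow> real^'n^'n \<Rightarrow> ('n \<Rightarrow> 'w process) \<Rightarrow> bool" where
  "nash_equilibrium Ad U \<theta> G a \<longleftrightarrow>
     (\<forall>i. is_arg_max (\<lambda>b. U b (local_aggregate G a i) (\<theta> i)) (\<lambda>b. b \<in> Ad i) (a i))"

text \<open>Uniqueness is uniqueness in the Hilbert space, i.e. up to \<open>proc_eq\<close> for every player.\<close>

definition unique_nash_equilibrium ::
    "'w measure \<Rightarrow> real \<Rightarrow> ('n::finite \<Rightarrow> 'w process set) \<Rightarrow>
       ('w process \<Rightarrow> 'w process \<Rightarrow> 'w process \<Rightarrow> real) \<Rightarrow>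
       ('n \<Rightarrow> 'w process) \<Rightarrow> real^'n^'n \<Rightarrow> bool" where
  "unique_nash_equilibrium M T Ad U \<theta> G \<longleftrightarrow>
     (\<exists>a. nash_equilibrium Ad U \<theta> G a \<and>
        (\<forall>b. nash_equilibrium Ad U \<theta> G b \<longrightarrow> (\<forall>i. proc_eq M T (b i) (a i))))"

definition symmetric_adjacency :: "real^'n^'n \<Rightarrow> bool" where
  "symmetric_adjacency G \<longleftrightarrow> transpose G = G \<and> (\<forall>i j. G $ i $ j \<in> {0..1})"

definition mat_eigenvalue :: "real^'n^'n \<Rightarrow> real \<Rightarrow> bool" where
  "mat_eigenvalue G k \<longleftrightarrow> (\<exists>v. v \<noteq> 0 \<and> G *v v = k *\<^sub>R v)"

text \<open>For symmetric \<open>G\<close> the set of real eigenvalues is finite and nonempty.\<close>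

definition largest_eigenvalue :: "real^'n^'n \<Rightarrow> real" where
  "largest_eigenvalue G = Max {k. mat_eigenvalue G k}"

end

theory Submission
  imports Defs
begin

text \<open>
  By strong concavity every player has a unique best reply to a given aggregate, and comparing the
  first-order conditions shows that it is \<open>l\<^sub>U / \<alpha>\<^sub>U\<close>-Lipschitz in the aggregate. By the triangle
  inequality the distances of the local aggregates of two profiles are bounded entrywise by \<open>G / N\<close>
  applied to the vector of players' distances, and the operator norm of the nonnegative symmetric
  matrix \<open>G\<close> is its largest eigenvalue. So the best reply map contracts with factor
  \<open>l\<^sub>U \<lambda>\<^sub>1(G) / (\<alpha>\<^sub>U N) < 1\<close>, and its fixed points are the Nash equilibria. Part (ii) follows from
  \<open>\<lambda>\<^sub>1(G) \<le> N\<close>; here \<open>l\<^sub>U \<ge> 0\<close> is forced by the Lipschitz condition, as \<open>\<A>\<close> contains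
  processes of positive norm.
\<close>

subsection \<open>Largest eigenvalue of a nonnegative symmetric matrix\<close>

lemma inner_symmetric_matrix:
  fixes G :: "real^'n^'n"
  assumes "transpose G = G"
  shows "(G *v x) \<bullet> y = x \<bullet> (G *v y)"
  by (metis assms dot_lmul_matrix vector_transpose_matrix)

text \<open>Eigenvectors of a symmetric matrix for distinct eigenvalues are orthogonal, and a
  Euclidean space has room for only finitely many pairwise orthogonal vectors. Finiteness makes the
  \<open>Max\<close> in \<open>largest_eigenvalue\<close> a genuine maximum.\<close>

lemma finite_eigenvalues_symmetric:
  fixes G :: "real^'n^'n"
  assumes sym: "transpose G = G"
  shows "finite {k. mat_eigenvalue G k}"
proof -
  have "\<forall>k. \<exists>v. mat_eigenvalue G k \<longrightarrow> v \<noteq> 0 \<and> G *v v = k *\<^sub>R v"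
    unfolding mat_eigenvalue_def by blast
  then obtain e where e: "\<And>k. mat_eigenvalue G k \<Longrightarrow> e k \<noteq> 0 \<and> G *v e k = k *\<^sub>R e k"
    by metis
  have orth: "e j \<bullet> e k = 0" if "mat_eigenvalue G j" "mat_eigenvalue G k" "j \<noteq> k" for j k
  proof -
    have "j * (e j \<bullet> e k) = k * (e j \<bullet> e k)"
      using inner_symmetric_matrix[OF sym, of "e j" "e k"] e that by simp
    then show ?thesis using that by simp
  qed
  \<comment> \<open>Two distinct eigenvalues sharing a chosen vector would make that vector
    orthogonal to itself, hence zero.\<close>
  have inj: "inj_on e {k. mat_eigenvalue G k}"
    by (rule inj_onI) (metis e inner_eq_zero_iff mem_Collect_eq orth)
  have "finite (e ` {k. mat_eigenvalue G k})"
    by (rule pairwise_orthogonal_imp_finite)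
      (use orth in \<open>auto simp: pairwise_def orthogonal_def\<close>)
  then show ?thesis using inj by (rule finite_imageD)
qed

text \<open>Equality case of Cauchy-Schwarz: in the expansion of |G x - L x|^2 the hypotheses bound
  |G x|^2 by L^2 |x|^2 and the cross term by -2 L^2 |x|^2, so nothing is left.\<close>

lemma norm_le_imp_eigenvector:
  fixes G :: "real^'n^'n"
  assumes "L * (x \<bullet> x) \<le> x \<bullet> (G *v x)" "norm (G *v x) \<le> L * norm x" "0 \<le> L"
  shows "G *v x = L *\<^sub>R x"
proof -
  have "(norm (G *v x))\<^sup>2 \<le> (L * norm x)\<^sup>2"
    using assms(2) by (intro power_mono) auto
  then have a: "(G *v x) \<bullet> (G *v x) \<le> L * (L * (x \<bullet> x))"
    by (simp add: power_mult_distrib power2_norm_eq_inner power2_eq_square[of L] mult.assoc)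
  have b: "L * (L * (x \<bullet> x)) \<le> L * (x \<bullet> (G *v x))"
    using assms by (intro mult_left_mono)
  have "(G *v x - L *\<^sub>R x) \<bullet> (G *v x - L *\<^sub>R x)
      = (G *v x) \<bullet> (G *v x) - 2 * (L * (x \<bullet> (G *v x))) + L * (L * (x \<bullet> x))"
    by (simp add: inner_diff_left inner_diff_right inner_commute algebra_simps)
  with a b have "(G *v x - L *\<^sub>R x) \<bullet> (G *v x - L *\<^sub>R x) \<le> 0" by simp
  then show ?thesis by (metis eq_iff_diff_eq_0 inner_eq_zero_iff inner_ge_zero order_antisym)
qed

text \<open>\<open>L\<close> is the operator norm, attained at a unit vector \<open>u\<close> by
  compactness. By symmetry the inner product of \<open>u\<close> with \<open>G *v (G *v u)\<close>
  is L^2, while the norm of \<open>G *v (G *v u)\<close> is at most L^2; the equality case then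
  makes \<open>u\<close> an eigenvector of the square of \<open>G\<close>.\<close>

lemma symmetric_matrix_norm_attained:
  fixes G :: "real^'n^'n"
  assumes sym: "transpose G = G"
  obtains u L where "u \<noteq> 0" "0 \<le> L" "G *v (G *v u) = (L * L) *\<^sub>R u"
    "\<And>v. norm (G *v v) \<le> L * norm v"
proof -
  have "compact (sphere 0 1 :: (real^'n) set)" "sphere 0 1 \<noteq> ({} :: (real^'n) set)"
    by auto
  moreover have "continuous_on (sphere 0 1) (\<lambda>v. norm (G *v v))"
    by (intro continuous_on_norm linear_continuous_on matrix_vector_mul_bounded_linear)
  ultimately have "\<exists>u\<in>sphere 0 1. \<forall>v\<in>sphere 0 1. norm (G *v v) \<le> norm (G *v u)"
    by (rule continuous_attains_sup)
  then obtain u :: "real^'n" where u: "norm u = 1"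
    and max: "\<And>v. norm v = 1 \<Longrightarrow> norm (G *v v) \<le> norm (G *v u)"
    by auto
  define L where "L = norm (G *v u)"
  have bound: "norm (G *v v) \<le> L * norm v" for v
  proof (cases "v = 0")
    case False
    have "norm (G *v ((1 / norm v) *\<^sub>R v)) \<le> L"
      unfolding L_def using False by (intro max) simp
    then have "norm (G *v v) / norm v \<le> L"
      by (simp add: matrix_vector_mult_scaleR)
    then show ?thesis using False by (simp add: divide_simps)
  qed simp
  have "norm (G *v (G *v u)) \<le> L * norm (G *v u)" by (rule bound)
  then have 1: "norm ((G ** G) *v u) \<le> (L * L) * norm u"
    by (simp add: L_def u matrix_vector_mul_assoc)
  have "u \<bullet> (G *v (G *v u)) = L * L"
    using inner_symmetric_matrix[OF sym, of u "G *v u"]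
    by (simp add: L_def dot_square_norm power2_eq_square)
  then have 2: "(L * L) * (u \<bullet> u) \<le> u \<bullet> ((G ** G) *v u)"
    using u by (simp add: matrix_vector_mul_assoc dot_square_norm)
  have "(G ** G) *v u = (L * L) *\<^sub>R u"
    by (rule norm_le_imp_eigenvector[OF 2 1]) simp
  moreover have "u \<noteq> 0" using u by auto
  ultimately show thesis
    using that[of u L] bound by (simp add: L_def matrix_vector_mul_assoc)
qed

text \<open>If \<open>-L\<close> is an eigenvalue with eigenvector \<open>v\<close>, then \<open>\<bar>v\<bar>\<close> is an eigenvector for \<open>L\<close>.\<close>

lemma nonneg_symmetric_norm_eigenvalue:
  fixes G :: "real^'n^'n"
  assumes sym: "transpose G = G" and nonneg: "\<And>i j. 0 \<le> G $ i $ j"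
  obtains L where "mat_eigenvalue G L" "0 \<le> L" "\<And>v. norm (G *v v) \<le> L * norm v"
proof -
  obtain u L where u: "u \<noteq> 0" and L: "0 \<le> L" and sq: "G *v (G *v u) = (L * L) *\<^sub>R u"
    and bound: "\<And>v. norm (G *v v) \<le> L * norm v"
    using symmetric_matrix_norm_attained[OF sym] by blast
  have "mat_eigenvalue G L"
  \<comment> \<open>Since (G - L)(G + L) u = 0, the vector (G + L) u is an eigenvector for
    \<open>L\<close> unless it vanishes, and then \<open>u\<close> is an eigenvector for
    \<open>-L\<close>.\<close>
  proof (cases "G *v u + L *\<^sub>R u = 0")
    case False
    moreover have "G *v (G *v u + L *\<^sub>R u) = L *\<^sub>R (G *v u + L *\<^sub>R u)"
      by (simp add: matrix_vector_right_distrib matrix_vector_mult_scaleR sq algebra_simps)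
    ultimately show ?thesis unfolding mat_eigenvalue_def by blast
  next
    case True
    then have neg: "G *v u = (- L) *\<^sub>R u" by (simp add: eq_neg_iff_add_eq_0)
    define x :: "real^'n" where "x = (\<chi> i. \<bar>u $ i\<bar>)"
    have xx: "x \<bullet> x = u \<bullet> u" by (simp add: x_def inner_vec_def)
    \<comment> \<open>Nonnegative entries let the absolute values pass onto the coordinates, so the
      Rayleigh quotient of \<open>x\<close> reaches the operator norm.\<close>
    have "\<bar>u \<bullet> (G *v u)\<bar> \<le> x \<bullet> (G *v x)"
      unfolding inner_vec_def matrix_vector_mult_def x_def
      by (auto intro!: order.trans[OF sum_abs] sum_mono mult_left_mono
          simp: abs_mult nonneg)
    then have "L * (x \<bullet> x) \<le> x \<bullet> (G *v x)"
      using L by (simp add: neg xx abs_mult)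
    moreover have "x \<noteq> 0" using u xx by (metis inner_eq_zero_iff)
    ultimately show ?thesis
      using norm_le_imp_eigenvector[OF _ bound L] unfolding mat_eigenvalue_def by blast
  qed
  then show thesis using that L bound by blast
qed

text \<open>The norm-dominating eigenvalue \<open>L\<close> found above is at most the maximal one.
  For the last claim, reading the eigenvector equation at a coordinate of largest modulus bounds the
  eigenvalue by a row sum of entries in [0,1].\<close>

lemma symmetric_adjacency_norm_le:
  fixes G :: "real^'n^'n"
  assumes "symmetric_adjacency G"
  shows "norm (G *v v) \<le> largest_eigenvalue G * norm v"
    and "0 \<le> largest_eigenvalue G"
    and "largest_eigenvalue G \<le> real CARD('n)"
proof -
  have sym: "transpose G = G" and G01: "\<And>i j. 0 \<le> G $ i $ j \<and> G $ i $ j \<le> 1"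
    using assms by (auto simp: symmetric_adjacency_def)
  obtain L where L: "mat_eigenvalue G L" "0 \<le> L" "\<And>v. norm (G *v v) \<le> L * norm v"
    using nonneg_symmetric_norm_eigenvalue[OF sym] G01 by blast
  note fin = finite_eigenvalues_symmetric[OF sym]
  have le: "L \<le> largest_eigenvalue G"
    unfolding largest_eigenvalue_def using fin L by (intro Max_ge) auto
  then show "norm (G *v v) \<le> largest_eigenvalue G * norm v" "0 \<le> largest_eigenvalue G"
    using L(2) L(3)[of v] mult_right_mono[OF le, of "norm v"] by auto
  have "mat_eigenvalue G (largest_eigenvalue G)"
    unfolding largest_eigenvalue_def using Max_in[OF fin] L by auto
  then obtain w where w: "w \<noteq> 0" "G *v w = largest_eigenvalue G *\<^sub>R w"
    unfolding mat_eigenvalue_def by blast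
  obtain i where i: "\<And>j. \<bar>w $ j\<bar> \<le> \<bar>w $ i\<bar>"
  proof -
    have "Max (range (\<lambda>j. \<bar>w $ j\<bar>)) \<in> range (\<lambda>j. \<bar>w $ j\<bar>)" by (intro Max_in) auto
    then obtain i where "Max (range (\<lambda>j. \<bar>w $ j\<bar>)) = \<bar>w $ i\<bar>" by blast
    then show thesis using that[of i] Max_ge[of "range (\<lambda>j. \<bar>w $ j\<bar>)"] by auto
  qed
  have "w $ i \<noteq> 0" using w(1) i by (auto simp: vec_eq_iff)
  have "largest_eigenvalue G * \<bar>w $ i\<bar> = \<bar>(G *v w) $ i\<bar>"
    using w \<open>0 \<le> largest_eigenvalue G\<close> by (simp add: abs_mult)
  also have "\<dots> \<le> (\<Sum>j\<in>UNIV. \<bar>G $ i $ j * w $ j\<bar>)"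
    by (simp add: matrix_vector_mult_def sum_abs)
  also have "\<dots> \<le> (\<Sum>j\<in>(UNIV :: 'n set). \<bar>w $ i\<bar>)"
  proof (rule sum_mono)
    fix j
    show "\<bar>G $ i $ j * w $ j\<bar> \<le> \<bar>w $ i\<bar>"
      using mult_mono[OF _ i, of "G $ i $ j" 1 j] G01 by (simp add: abs_mult)
  qed
  also have "\<dots> = real CARD('n) * \<bar>w $ i\<bar>" by simp
  finally show "largest_eigenvalue G \<le> real CARD('n)" using \<open>w $ i \<noteq> 0\<close> by simp
qed

subsection \<open>The Hilbert space of progressively measurable processes\<close>

context filtered_prob_space
begin

section \<open>Processes as square-integrable functions on the product space\<close>

definition product_measure :: "('w \<times> real) measure" where
  "product_measure = M \<Otimes>\<^sub>M restrict_space lborel {0..T}"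

lemma finite_time_measure: "finite_measure (restrict_space lborel {0..T})"
  by (rule finite_measureI) (use horizon_pos in \<open>simp add: emeasure_restrict_space space_restrict_space\<close>)

sublocale time: finite_measure "restrict_space lborel {0..T}"
  by (rule finite_time_measure)

sublocale space_time: pair_sigma_finite M "restrict_space lborel {0..T}" ..

sublocale product: finite_measure product_measure
  unfolding product_measure_def
  by (intro finite_measure_pair_measure finite_measure_axioms finite_time_measure)

text \<open>Progressive measurability at the final time \<open>T\<close> is joint measurability for
  \<open>F T\<close>, and the identity carries it over to the larger sigma-algebra of
  \<open>M\<close>.\<close>

lemma progressively_measurable_product:
  assumes "progressively_measurable F T a"
  shows "(\<lambda>x. a (fst x) (snd x)) \<in> borel_measurable product_measure"
proof -
  have T: "T \<in> {0..T}" using horizon_pos by simp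
  have m: "(\<lambda>x. a (fst x) (snd x)) \<in> borel_measurable (F T \<Otimes>\<^sub>M restrict_space borel {0..T})"
    using assms T by (auto simp: progressively_measurable_def case_prod_beta')
  have "(\<lambda>x. x) \<in> measurable M (F T)"
    using subalgebras[OF T] by (auto simp: subalgebra_def measurable_def)
  moreover have "(\<lambda>x. x) \<in> measurable (restrict_space lborel {0..T}) (restrict_space borel {0..T})"
    by (subst measurable_cong_sets[where M'="restrict_space borel {0..T}" and N'="restrict_space borel {0..T}"])
      (auto intro!: sets_restrict_space_cong)
  ultimately have "(\<lambda>x. (fst x, snd x)) \<in> measurable product_measure (F T \<Otimes>\<^sub>M restrict_space borel {0..T})"
    unfolding product_measure_def
    by (intro measurable_Pair measurable_compose[OF measurable_fst] measurable_compose[OF measurable_snd])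
  from measurable_compose[OF this m] show ?thesis by simp
qed

text \<open>Tonelli merges the iterated integral into one over \<open>product_measure\<close>, which
  reduces membership to measurability and square integrability.\<close>

lemma proc_space_iff:
  "a \<in> proc_space M F T \<longleftrightarrow> progressively_measurable F T a \<and>
     integrable product_measure (\<lambda>x. (a (fst x) (snd x))\<^sup>2)"
proof (cases "progressively_measurable F T a")
  case True
  note m[measurable] = progressively_measurable_product[OF True]
  have "(\<integral>\<^sup>+ t. (\<integral>\<^sup>+ w. ennreal ((a w t)\<^sup>2) \<partial>M) * indicator {0..T} t \<partial>lborel)
      = (\<integral>\<^sup>+ t. (\<integral>\<^sup>+ w. ennreal ((a w t)\<^sup>2) \<partial>M) \<partial>restrict_space lborel {0..T})"
    by (subst nn_integral_restrict_space) auto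
  also have "\<dots> = (\<integral>\<^sup>+ x. ennreal ((a (fst x) (snd x))\<^sup>2) \<partial>product_measure)"
    using m unfolding product_measure_def
    by (subst space_time.nn_integral_snd[symmetric]) auto
  finally show ?thesis
    using True by (simp add: proc_space_def integrable_iff_bounded)
qed (simp add: proc_space_def)

lemma proc_space_measurable:
  "a \<in> proc_space M F T \<Longrightarrow> (\<lambda>x. a (fst x) (snd x)) \<in> borel_measurable product_measure"
  by (simp add: proc_space_iff progressively_measurable_product)

lemma proc_space_integrable_mult:
  assumes "a \<in> proc_space M F T" "b \<in> proc_space M F T"
  shows "integrable product_measure (\<lambda>x. a (fst x) (snd x) * b (fst x) (snd x))"
proof (rule Bochner_Integration.integrable_bound)
  show "integrable product_measure (\<lambda>x. (a (fst x) (snd x))\<^sup>2 + (b (fst x) (snd x))\<^sup>2)"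
    using assms by (simp add: proc_space_iff)
  show "(\<lambda>x. a (fst x) (snd x) * b (fst x) (snd x)) \<in> borel_measurable product_measure"
    using assms by (intro borel_measurable_times proc_space_measurable)
  have "\<bar>u * v\<bar> \<le> u\<^sup>2 + v\<^sup>2" for u v :: real
  proof -
    have "2 * (\<bar>u\<bar> * \<bar>v\<bar>) \<le> u\<^sup>2 + v\<^sup>2"
      using sum_squares_bound[of "\<bar>u\<bar>" "\<bar>v\<bar>"] by simp
    moreover have "0 \<le> \<bar>u\<bar> * \<bar>v\<bar>" by simp
    ultimately show ?thesis unfolding abs_mult by linarith
  qed
  then show "AE x in product_measure. norm (a (fst x) (snd x) * b (fst x) (snd x))
      \<le> norm ((a (fst x) (snd x))\<^sup>2 + (b (fst x) (snd x))\<^sup>2)"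
    by (intro AE_I2) (simp add: abs_of_nonneg)
qed

lemma proc_inner_eq:
  assumes "a \<in> proc_space M F T" "b \<in> proc_space M F T"
  shows "proc_inner M T a b = (LINT x|product_measure. a (fst x) (snd x) * b (fst x) (snd x))"
  using space_time.integral_fst'[of "\<lambda>x. a (fst x) (snd x) * b (fst x) (snd x)"]
    proc_space_integrable_mult[OF assms]
  by (simp add: proc_inner_def product_measure_def set_lebesgue_integral_def integral_restrict_space)

text \<open>\<open>proc_norm\<close> integrates over states first and \<open>proc_inner\<close> over
  time first; Fubini identifies both with the product integral.\<close>

lemma proc_norm_eq:
  assumes "a \<in> proc_space M F T"
  shows "proc_norm M T a = sqrt (proc_inner M T a a)"
  using space_time.integral_snd[of "\<lambda>w t. (a w t)\<^sup>2"] assms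
  by (simp add: proc_inner_eq proc_norm_def product_measure_def set_lebesgue_integral_def
      integral_restrict_space proc_space_iff case_prod_beta' power2_eq_square)

section \<open>Linear structure, inner product and seminorm\<close>

lemma proc_inner_self_nonneg: "a \<in> proc_space M F T \<Longrightarrow> 0 \<le> proc_inner M T a a"
  by (simp add: proc_inner_eq)

lemma proc_norm_nonneg: "a \<in> proc_space M F T \<Longrightarrow> 0 \<le> proc_norm M T a"
  by (simp add: proc_norm_eq proc_inner_self_nonneg)

lemma proc_norm_power2: "a \<in> proc_space M F T \<Longrightarrow> (proc_norm M T a)\<^sup>2 = proc_inner M T a a"
  by (simp add: proc_norm_eq proc_inner_self_nonneg)

lemma proc_add_in [intro, simp]:
  assumes "a \<in> proc_space M F T" "b \<in> proc_space M F T"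
  shows "proc_add a b \<in> proc_space M F T"
proof -
  have "integrable product_measure (\<lambda>x. (a (fst x) (snd x))\<^sup>2 + (b (fst x) (snd x))\<^sup>2
      + 2 * (a (fst x) (snd x) * b (fst x) (snd x)))"
    using assms proc_space_integrable_mult[OF assms] by (simp add: proc_space_iff)
  moreover have "progressively_measurable F T (proc_add a b)"
    using assms unfolding proc_space_iff
    by (simp add: proc_add_def progressively_measurable_def case_prod_beta'
        borel_measurable_add)
  ultimately show ?thesis
    unfolding proc_space_iff by (simp add: proc_add_def power2_sum mult.assoc)
qed

lemma proc_scale_in [intro, simp]:
  "a \<in> proc_space M F T \<Longrightarrow> proc_scale c a \<in> proc_space M F T"
  unfolding proc_space_iff
  by (auto simp: proc_scale_def progressively_measurable_def case_prod_beta' power_mult_distrib)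

lemma proc_diff_eq: "proc_diff a b = proc_add a (proc_scale (- 1) b)"
  by (simp add: proc_diff_def proc_add_def proc_scale_def)

lemma proc_diff_in [intro, simp]:
  "a \<in> proc_space M F T \<Longrightarrow> b \<in> proc_space M F T \<Longrightarrow> proc_diff a b \<in> proc_space M F T"
  by (simp add: proc_diff_eq)

text \<open>Holds because \<open>product_measure\<close> is finite. The constant 1 later turns L2
  bounds into L1 bounds and serves as a process of positive norm.\<close>

lemma proc_const_in [intro, simp]: "(\<lambda>w t. c) \<in> proc_space M F T"
  by (simp add: proc_space_iff progressively_measurable_def)

lemma proc_inner_commute: "a \<in> proc_space M F T \<Longrightarrow> b \<in> proc_space M F T \<Longrightarrow>
    proc_inner M T a b = proc_inner M T b a"
  by (simp add: proc_inner_eq mult.commute)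

lemma proc_inner_add_left:
  assumes "a \<in> proc_space M F T" "b \<in> proc_space M F T" "c \<in> proc_space M F T"
  shows "proc_inner M T (proc_add a b) c = proc_inner M T a c + proc_inner M T b c"
  using assms proc_space_integrable_mult
  by (simp add: proc_inner_eq) (simp add: proc_add_def distrib_right)

lemma proc_inner_scale_left:
  assumes "a \<in> proc_space M F T" "b \<in> proc_space M F T"
  shows "proc_inner M T (proc_scale k a) b = k * proc_inner M T a b"
  using assms by (simp add: proc_inner_eq) (simp add: proc_scale_def mult.assoc)

lemma proc_inner_add_right:
  assumes "a \<in> proc_space M F T" "b \<in> proc_space M F T" "c \<in> proc_space M F T"
  shows "proc_inner M T c (proc_add a b) = proc_inner M T c a + proc_inner M T c b"
  using assms by (simp add: proc_inner_add_left proc_inner_commute[of c])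

lemma proc_inner_scale_right:
  assumes "a \<in> proc_space M F T" "b \<in> proc_space M F T"
  shows "proc_inner M T b (proc_scale k a) = k * proc_inner M T b a"
  using assms by (simp add: proc_inner_scale_left proc_inner_commute[of b])

lemma proc_inner_diff_left:
  assumes "a \<in> proc_space M F T" "b \<in> proc_space M F T" "c \<in> proc_space M F T"
  shows "proc_inner M T (proc_diff a b) c = proc_inner M T a c - proc_inner M T b c"
  using assms by (simp add: proc_diff_eq proc_inner_add_left proc_inner_scale_left)

lemma proc_inner_diff_right:
  assumes "a \<in> proc_space M F T" "b \<in> proc_space M F T" "c \<in> proc_space M F T"
  shows "proc_inner M T c (proc_diff a b) = proc_inner M T c a - proc_inner M T c b"
  using assms by (simp add: proc_diff_eq proc_inner_add_right proc_inner_scale_right)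

lemmas proc_inner_simps =
  proc_inner_add_left proc_inner_add_right proc_inner_diff_left proc_inner_diff_right
  proc_inner_scale_left proc_inner_scale_right

lemma proc_norm_scale: "a \<in> proc_space M F T \<Longrightarrow> proc_norm M T (proc_scale k a) = \<bar>k\<bar> * proc_norm M T a"
  by (simp add: proc_norm_eq proc_inner_simps real_sqrt_mult)

lemma proc_norm_minus_commute:
  assumes "a \<in> proc_space M F T" "b \<in> proc_space M F T"
  shows "proc_norm M T (proc_diff a b) = proc_norm M T (proc_diff b a)"
  using assms by (simp add: proc_norm_eq proc_inner_simps)

text \<open>Cauchy-Schwarz, by testing the nonnegative quadratic <a + k b, a + k b> at its minimiser
  in \<open>k\<close>. On representatives the form is only semidefinite, so a \<open>b\<close> of
  norm zero is a separate case.\<close>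

lemma proc_inner_abs_le:
  assumes a: "a \<in> proc_space M F T" and b: "b \<in> proc_space M F T"
  shows "\<bar>proc_inner M T a b\<bar> \<le> proc_norm M T a * proc_norm M T b"
proof -
  let ?A = "proc_norm M T a" and ?B = "proc_norm M T b" and ?i = "proc_inner M T a b"
  note [simp] = proc_inner_simps a b
  have quad: "0 \<le> proc_inner M T a a + 2 * k * ?i + k * k * proc_inner M T b b" for k
    using proc_inner_self_nonneg[of "proc_add a (proc_scale k b)"]
    by (simp add: proc_inner_commute[OF b a] algebra_simps)
  have "?i\<^sup>2 \<le> proc_inner M T a a * proc_inner M T b b"
  proof (cases "proc_inner M T b b = 0")
    case True
    have "?i = 0"
    proof (rule ccontr)
      assume "?i \<noteq> 0"
      \<comment> \<open>For \<open>b\<close> of norm zero the quadratic is affine in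
        \<open>k\<close>; this choice of \<open>k\<close> gives it the value -1.\<close>
      then have "2 * (- (proc_inner M T a a + 1) / (2 * ?i)) * ?i = - (proc_inner M T a a + 1)"
        by (simp add: divide_simps)
      then show False
        using quad[of "- (proc_inner M T a a + 1) / (2 * ?i)"] unfolding True by linarith
    qed
    then show ?thesis using True by simp
  next
    case False
    with proc_inner_self_nonneg[OF b] have "proc_inner M T b b > 0" by simp
    then show ?thesis
      using quad[of "- ?i / proc_inner M T b b"]
      by (simp add: field_simps power2_eq_square)
  qed
  then have "\<bar>?i\<bar>\<^sup>2 \<le> (?A * ?B)\<^sup>2" by (simp add: power_mult_distrib proc_norm_power2)
  then show ?thesis by (rule power2_le_imp_le) (simp add: proc_norm_nonneg)
qed

lemma proc_norm_add_le:
  assumes a: "a \<in> proc_space M F T" and b: "b \<in> proc_space M F T"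
  shows "proc_norm M T (proc_add a b) \<le> proc_norm M T a + proc_norm M T b"
proof (rule power2_le_imp_le)
  show "(proc_norm M T (proc_add a b))\<^sup>2 \<le> (proc_norm M T a + proc_norm M T b)\<^sup>2"
    using assms proc_inner_abs_le[OF assms]
    by (simp add: proc_norm_power2 power2_sum proc_inner_simps proc_inner_commute[OF b a])
qed (use assms in \<open>simp add: proc_norm_nonneg\<close>)

lemma proc_norm_triangle:
  assumes "a \<in> proc_space M F T" "b \<in> proc_space M F T" "c \<in> proc_space M F T"
  shows "proc_norm M T (proc_diff a c) \<le> proc_norm M T (proc_diff a b) + proc_norm M T (proc_diff b c)"
proof -
  have "proc_diff a c = proc_add (proc_diff a b) (proc_diff b c)"
    by (simp add: proc_diff_def proc_add_def)
  then show ?thesis using assms by (simp add: proc_norm_add_le)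
qed

text \<open>Zero distance becomes equality of elements here: a nonnegative function with zero
  integral vanishes almost everywhere.\<close>

lemma proc_eq_if_norm_zero:
  assumes "a \<in> proc_space M F T" "b \<in> proc_space M F T" "proc_norm M T (proc_diff a b) = 0"
  shows "proc_eq M T a b"
proof -
  have d: "proc_diff a b \<in> proc_space M F T" using assms by simp
  then have "(LINT x|product_measure. (proc_diff a b (fst x) (snd x))\<^sup>2) = 0"
    using assms(3) proc_norm_power2[OF d] by (simp add: proc_inner_eq power2_eq_square)
  then have "AE x in product_measure. (proc_diff a b (fst x) (snd x))\<^sup>2 = 0"
    using d by (subst (asm) integral_nonneg_eq_0_iff_AE) (auto simp: proc_space_iff)
  then show ?thesis
    unfolding proc_eq_def product_measure_def[symmetric] by (simp add: proc_diff_def)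
qed

lemma proc_sum_in [simp]:
  assumes "finite I" "\<And>i. i \<in> I \<Longrightarrow> a i \<in> proc_space M F T"
  shows "(\<lambda>w t. \<Sum>i\<in>I. a i w t) \<in> proc_space M F T"
  using assms
proof (induction I)
  case (insert i I)
  then have "proc_add (a i) (\<lambda>w t. \<Sum>i\<in>I. a i w t) \<in> proc_space M F T" by blast
  with insert.hyps show ?case by (simp add: proc_add_def)
qed simp

lemma proc_norm_sum_le:
  assumes "finite I" "\<And>i. i \<in> I \<Longrightarrow> a i \<in> proc_space M F T"
  shows "proc_norm M T (\<lambda>w t. \<Sum>i\<in>I. a i w t) \<le> (\<Sum>i\<in>I. proc_norm M T (a i))"
  using assms
proof (induction I)
  case (insert i I)
  then have "proc_norm M T (proc_add (a i) (\<lambda>w t. \<Sum>i\<in>I. a i w t))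
      \<le> proc_norm M T (a i) + proc_norm M T (\<lambda>w t. \<Sum>i\<in>I. a i w t)"
    by (intro proc_norm_add_le) auto
  with insert show ?case by (simp add: proc_add_def)
qed (simp add: proc_norm_def)

section \<open>Completeness with progressive measurability preserved\<close>

lemma nn_integral_proc_power2:
  assumes "a \<in> proc_space M F T"
  shows "(\<integral>\<^sup>+ x. ennreal ((a (fst x) (snd x))\<^sup>2) \<partial>product_measure) = ennreal ((proc_norm M T a)\<^sup>2)"
proof -
  have "(proc_norm M T a)\<^sup>2 = (LINT x|product_measure. (a (fst x) (snd x))\<^sup>2)"
    unfolding proc_norm_power2[OF assms] proc_inner_eq[OF assms assms]
    by (simp add: power2_eq_square)
  then show ?thesis
    using assms by (subst nn_integral_eq_integral) (auto simp: proc_space_iff)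
qed

text \<open>Stated with the nonnegative integral so that a bound coming from Fatou applies before
  integrability is known.\<close>

lemma proc_space_if_nn_integral_le:
  assumes prog: "progressively_measurable F T a" and "0 \<le> C"
    and le: "(\<integral>\<^sup>+ x. ennreal ((a (fst x) (snd x))\<^sup>2) \<partial>product_measure) \<le> ennreal (C\<^sup>2)"
  shows "a \<in> proc_space M F T" "proc_norm M T a \<le> C"
proof -
  have fin: "(\<integral>\<^sup>+ x. ennreal ((a (fst x) (snd x))\<^sup>2) \<partial>product_measure) < \<infinity>"
    using le by (rule le_less_trans) simp
  have "integrable product_measure (\<lambda>x. (a (fst x) (snd x))\<^sup>2)"
    by (rule integrableI_nonneg[OF _ _ fin])
      (simp_all add: borel_measurable_power progressively_measurable_product[OF prog])
  with prog show a: "a \<in> proc_space M F T"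
    unfolding proc_space_iff by (rule conjI)
  have "(proc_norm M T a)\<^sup>2 \<le> C\<^sup>2"
    using le unfolding nn_integral_proc_power2[OF a] by simp
  then show "proc_norm M T a \<le> C"
    using \<open>0 \<le> C\<close> by (rule power2_le_imp_le)
qed

text \<open>Where the sequence diverges, \<open>lim\<close> is one fixed unspecified value, so the
  limit stays measurable for every \<open>F t\<close> without removing null sets.\<close>

lemma progressively_measurable_lim:
  assumes "\<And>n. progressively_measurable F T (a n)"
  shows "progressively_measurable F T (\<lambda>w t. lim (\<lambda>n::nat. a n w t))"
  using assms
  by (simp add: progressively_measurable_def case_prod_beta' borel_measurable_lim_metric)

lemma progressively_measurable_diff:
  assumes "progressively_measurable F T a" "progressively_measurable F T b"
  shows "progressively_measurable F T (proc_diff a b)"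
  using assms
  by (simp add: progressively_measurable_def case_prod_beta' proc_diff_def borel_measurable_diff)

text \<open>Cauchy-Schwarz against the constant 1; it lets L2 increments be summed in L1.\<close>

lemma nn_integral_proc_abs_le:
  assumes "a \<in> proc_space M F T"
  shows "(\<integral>\<^sup>+ x. ennreal \<bar>a (fst x) (snd x)\<bar> \<partial>product_measure)
      \<le> ennreal (proc_norm M T a * proc_norm M T (\<lambda>w t. 1))"
proof -
  let ?b = "\<lambda>w t. \<bar>a w t\<bar>"
  have b: "?b \<in> proc_space M F T"
    using assms
    by (simp add: proc_space_iff progressively_measurable_def case_prod_beta' borel_measurable_abs)
  have "integrable product_measure (\<lambda>x. \<bar>a (fst x) (snd x)\<bar>)"
    using proc_space_integrable_mult[OF b proc_const_in[of 1]] by simp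
  then have "(\<integral>\<^sup>+ x. ennreal \<bar>a (fst x) (snd x)\<bar> \<partial>product_measure)
      = ennreal (proc_inner M T ?b (\<lambda>w t. 1))"
    by (subst nn_integral_eq_integral) (simp_all add: proc_inner_eq b)
  also have "\<dots> \<le> ennreal (proc_norm M T ?b * proc_norm M T (\<lambda>w t. 1))"
    using proc_inner_abs_le[OF b proc_const_in[of 1]] by (intro ennreal_leI) simp
  also have "proc_norm M T ?b = proc_norm M T a"
    by (simp add: proc_norm_def)
  finally show ?thesis .
qed

text \<open>The pointwise limit taken here, rather than an abstract limit in \<open>L\<^sup>2\<close>, keeps progressive
  measurability.\<close>

lemma proc_space_limit:
  assumes a: "\<And>n::nat. a n \<in> proc_space M F T"
    and inc: "\<And>n. proc_norm M T (proc_diff (a (Suc n)) (a n)) \<le> r n"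
    and r: "summable r"
  obtains l where "l \<in> proc_space M F T" "(\<lambda>n. proc_norm M T (proc_diff (a n) l)) \<longlonglongrightarrow> 0"
proof -
  define l where "l = (\<lambda>w t. lim (\<lambda>n. a n w t))"
  define R where "R n = (\<Sum>k. r (k + n))" for n
  have r_nonneg: "0 \<le> r n" for n
    by (rule order.trans[OF proc_norm_nonneg inc]) (simp add: a)
  have R_nonneg: "0 \<le> R n" for n
    unfolding R_def by (rule suminf_nonneg) (use r r_nonneg in \<open>simp_all add: summable_iff_shift\<close>)
  have tail: "proc_norm M T (proc_diff (a n) (a m)) \<le> R n" if "n \<le> m" for n m
  proof -
    have "proc_norm M T (proc_diff (a (j + n)) (a n)) \<le> (\<Sum>k<j. r (k + n))" for j
    proof (induction j)
      case 0
      show ?case by (simp add: proc_diff_def proc_norm_def)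
    next
      case (Suc j)
      then show ?case
        using proc_norm_triangle[of "a (Suc (j + n))" "a (j + n)" "a n"] a inc[of "j + n"] by simp
    qed
    also have "(\<Sum>k<j. r (k + n)) \<le> R n" for j
      unfolding R_def by (rule sum_le_suminf) (use r r_nonneg in \<open>simp_all add: summable_iff_shift\<close>)
    finally have "proc_norm M T (proc_diff (a (m - n + n)) (a n)) \<le> R n" .
    then show ?thesis using that by (simp add: proc_norm_minus_commute[of "a n"] a)
  qed
  have prog: "progressively_measurable F T (a n)" for n
    using a by (simp add: proc_space_iff)
  have prog_l: "progressively_measurable F T l"
    unfolding l_def using prog by (rule progressively_measurable_lim)
  \<comment> \<open>The sum of all absolute increments has finite integral, so it is finite almost
    everywhere; there the telescoping series converges absolutely.\<close>
  have conv: "AE x in product_measure. (\<lambda>n. a n (fst x) (snd x)) \<longlonglongrightarrow> l (fst x) (snd x)"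
  proof -
    define d where "d n x = \<bar>a (Suc n) (fst x) (snd x) - a n (fst x) (snd x)\<bar>" for n x
    let ?C = "proc_norm M T (\<lambda>w t. 1)"
    have d_meas: "d n \<in> borel_measurable product_measure" for n
      unfolding d_def
      by (intro borel_measurable_abs borel_measurable_diff progressively_measurable_product[OF prog])
    have C: "0 \<le> ?C" by (simp add: proc_norm_nonneg)
    have "(\<integral>\<^sup>+ x. (\<Sum>n. ennreal (d n x)) \<partial>product_measure)
        = (\<Sum>n. \<integral>\<^sup>+ x. ennreal (d n x) \<partial>product_measure)"
      by (intro nn_integral_suminf measurable_compose[OF d_meas] measurable_ennreal)
    also have "\<dots> \<le> (\<Sum>n. ennreal (r n * ?C))"
    proof (intro suminf_le summableI)
      fix n
      have "(\<integral>\<^sup>+ x. ennreal (d n x) \<partial>product_measure)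
          \<le> ennreal (proc_norm M T (proc_diff (a (Suc n)) (a n)) * ?C)"
        using nn_integral_proc_abs_le[OF proc_diff_in[OF a a], of "Suc n" n]
        by (simp add: d_def proc_diff_def)
      also have "\<dots> \<le> ennreal (r n * ?C)"
        by (intro ennreal_leI mult_right_mono inc C)
      finally show "(\<integral>\<^sup>+ x. ennreal (d n x) \<partial>product_measure) \<le> ennreal (r n * ?C)" .
    qed
    also have "\<dots> < \<infinity>"
      by (subst suminf_ennreal2) (simp_all add: r_nonneg C r summable_mult2)
    finally have "AE x in product_measure. (\<Sum>n. ennreal (d n x)) \<noteq> \<infinity>"
      by (intro nn_integral_PInf_AE borel_measurable_suminf_order
          measurable_compose[OF d_meas] measurable_ennreal) simp
    then show ?thesis
    proof eventually_elim
      case (elim x)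
      then have "summable (\<lambda>n. d n x)"
        by (intro summable_suminf_not_top) (auto simp: d_def)
      then have "summable (\<lambda>n. a (Suc n) (fst x) (snd x) - a n (fst x) (snd x))"
        unfolding d_def by (rule summable_rabs_cancel)
      then have "convergent (\<lambda>m. a m (fst x) (snd x) - a 0 (fst x) (snd x))"
        unfolding summable_iff_convergent
          sum_lessThan_telescope[of "\<lambda>n. a n (fst x) (snd x)"] .
      then have "convergent (\<lambda>m. a m (fst x) (snd x))"
        by (rule convergent_diff_const_right_iff[THEN iffD1])
      then show ?case unfolding l_def convergent_LIMSEQ_iff .
    qed
  qed
  \<comment> \<open>Fatou in \<open>m\<close> with \<open>n\<close> fixed, using the uniform bound
    \<open>tail\<close>, gives membership and the rate \<open>R n\<close> together.\<close>
  have dl: "proc_diff (a n) l \<in> proc_space M F T \<and> proc_norm M T (proc_diff (a n) l) \<le> R n" for n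
  proof -
    let ?e = "\<lambda>b x. ennreal ((proc_diff (a n) b (fst x) (snd x))\<^sup>2)"
    have "(\<integral>\<^sup>+ x. ?e l x \<partial>product_measure)
        = (\<integral>\<^sup>+ x. liminf (\<lambda>m. ?e (a m) x) \<partial>product_measure)"
    proof (rule nn_integral_cong_AE)
      show "AE x in product_measure. ?e l x = liminf (\<lambda>m. ?e (a m) x)"
        using conv
      proof eventually_elim
        case (elim x)
        have "(\<lambda>m. ?e (a m) x) \<longlonglongrightarrow> ?e l x"
          unfolding proc_diff_def
          by (rule tendsto_ennrealI[OF tendsto_power[OF tendsto_diff[OF tendsto_const elim]]])
        from lim_imp_Liminf[OF sequentially_bot this] show ?case by (rule sym)
      qed
    qed
    also have "\<dots> \<le> liminf (\<lambda>m. \<integral>\<^sup>+ x. ?e (a m) x \<partial>product_measure)"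
      by (intro nn_integral_liminf measurable_compose[OF _ measurable_ennreal]
          borel_measurable_power
          progressively_measurable_product[OF progressively_measurable_diff[OF prog prog]])
    also have "\<dots> = liminf (\<lambda>m. ennreal ((proc_norm M T (proc_diff (a n) (a m)))\<^sup>2))"
      by (simp add: nn_integral_proc_power2 a)
    also have "\<dots> \<le> liminf (\<lambda>m::nat. ennreal ((R n)\<^sup>2))"
    proof (rule Liminf_mono)
      show "\<forall>\<^sub>F m in sequentially.
          ennreal ((proc_norm M T (proc_diff (a n) (a m)))\<^sup>2) \<le> ennreal ((R n)\<^sup>2)"
        using eventually_ge_at_top[of n]
        by eventually_elim (intro ennreal_leI power_mono tail proc_norm_nonneg proc_diff_in a)
    qed
    also have "\<dots> = ennreal ((R n)\<^sup>2)" by (simp add: Liminf_const)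
    finally show ?thesis
      using proc_space_if_nn_integral_le[OF progressively_measurable_diff[OF prog prog_l] R_nonneg]
      by blast
  qed
  \<comment> \<open>Only differences with \<open>l\<close> are known to lie in the space, so
    \<open>l\<close> is recovered as a0 - (a0 - l).\<close>
  have "proc_diff (a 0) (proc_diff (a 0) l) \<in> proc_space M F T" using dl[of 0] a[of 0] by blast
  then have l: "l \<in> proc_space M F T" by (simp add: proc_diff_def)
  moreover have "(\<lambda>n. proc_norm M T (proc_diff (a n) l)) \<longlonglongrightarrow> 0"
  proof (rule tendsto_sandwich[OF _ _ tendsto_const])
    show "R \<longlonglongrightarrow> 0" unfolding R_def using r by (rule suminf_exist_split2)
  qed (use dl l a in \<open>auto simp: proc_norm_nonneg\<close>)
  ultimately show thesis by (rule that)
qed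

subsection \<open>Maximisers of strongly concave functionals\<close>

lemma proc_convexD:
  "proc_convex S \<Longrightarrow> a \<in> S \<Longrightarrow> b \<in> S \<Longrightarrow> 0 \<le> u \<Longrightarrow> u \<le> 1 \<Longrightarrow>
    proc_add (proc_scale (1 - u) a) (proc_scale u b) \<in> S"
  by (simp add: proc_convex_def)

text \<open>Rests on the identity |(1-u) a + u b|^2 = (1-u) |a|^2 + u |b|^2 - u (1-u) |b - a|^2,
  which converts concavity of the shifted functional into a quadratic gain along the
  segment.\<close>

lemma strongly_concaveD:
  assumes f: "strongly_concave M F T \<alpha> f" and a: "a \<in> proc_space M F T"
    and b: "b \<in> proc_space M F T" and u: "0 \<le> u" "u \<le> 1"
  shows "(1 - u) * f a + u * f b + \<alpha> / 2 * (u * (1 - u)) * (proc_norm M T (proc_diff b a))\<^sup>2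
    \<le> f (proc_add (proc_scale (1 - u) a) (proc_scale u b))"
proof -
  define h where "h = \<alpha> / 2"
  let ?c = "proc_add (proc_scale (1 - u) a) (proc_scale u b)"
  have "(proc_norm M T ?c)\<^sup>2 = (1 - u) * (proc_norm M T a)\<^sup>2 + u * (proc_norm M T b)\<^sup>2
      - u * (1 - u) * (proc_norm M T (proc_diff b a))\<^sup>2"
    using a b by (simp add: proc_norm_power2 proc_inner_simps proc_inner_commute[OF b a]) algebra
  then have "h * (proc_norm M T ?c)\<^sup>2 = h * ((1 - u) * (proc_norm M T a)\<^sup>2
      + u * (proc_norm M T b)\<^sup>2 - u * (1 - u) * (proc_norm M T (proc_diff b a))\<^sup>2)"
    by simp
  moreover have "(1 - u) * (f a + h * (proc_norm M T a)\<^sup>2)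
      + u * (f b + h * (proc_norm M T b)\<^sup>2) \<le> f ?c + h * (proc_norm M T ?c)\<^sup>2"
    using f a b u by (simp add: strongly_concave_def proc_concave_def h_def)
  ultimately show ?thesis unfolding h_def[symmetric] by (simp add: algebra_simps)
qed

text \<open>The direction b - a turns the difference quotient into one along the segment; the limit
  is one-sided because convexity only controls weights in [0,1].\<close>

lemma gateaux_gradient_right_limit:
  assumes g: "has_gateaux_gradient M F T f g a"
    and a: "a \<in> proc_space M F T" and b: "b \<in> proc_space M F T"
  shows "((\<lambda>u. (f (proc_add (proc_scale (1 - u) a) (proc_scale u b)) - f a) / u)
      \<longlongrightarrow> proc_inner M T g (proc_diff b a)) (at_right 0)"
proof -
  have "proc_add a (proc_scale u (proc_diff b a)) = proc_add (proc_scale (1 - u) a) (proc_scale u b)"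
    for u
    by (simp add: proc_add_def proc_scale_def proc_diff_def algebra_simps)
  moreover have "((\<lambda>u. (f (proc_add a (proc_scale u (proc_diff b a))) - f a) / u)
      \<longlongrightarrow> proc_inner M T g (proc_diff b a)) (at 0)"
    using g a b by (simp add: has_gateaux_gradient_def)
  ultimately show ?thesis by (simp add: filterlim_at_split)
qed

text \<open>Divide the segment inequality by \<open>u\<close> and let \<open>u\<close> decrease to
  0: the functional lies below its tangent by a quadratic margin.\<close>

lemma strongly_concave_gradient_le:
  assumes f: "strongly_concave M F T \<alpha> f" and g: "has_gateaux_gradient M F T f g a"
    and a: "a \<in> proc_space M F T" and b: "b \<in> proc_space M F T"
  shows "f b + \<alpha> / 2 * (proc_norm M T (proc_diff b a))\<^sup>2 \<le> f a + proc_inner M T g (proc_diff b a)"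
proof -
  let ?D = "(proc_norm M T (proc_diff b a))\<^sup>2"
  have "f b - f a + \<alpha> / 2 * (1 - 0) * ?D \<le> proc_inner M T g (proc_diff b a)"
  proof (rule tendsto_le[OF _ gateaux_gradient_right_limit[OF g a b]])
    show "((\<lambda>u. f b - f a + \<alpha> / 2 * (1 - u) * ?D)
        \<longlongrightarrow> f b - f a + \<alpha> / 2 * (1 - 0) * ?D) (at_right 0)"
      by (intro tendsto_intros)
    show "\<forall>\<^sub>F u in at_right 0. f b - f a + \<alpha> / 2 * (1 - u) * ?D
        \<le> (f (proc_add (proc_scale (1 - u) a) (proc_scale u b)) - f a) / u"
    proof (rule eventually_at_rightI)
      fix u :: real assume "u \<in> {0<..<1}"
      then have u: "0 < u" "u \<le> 1" by auto
      have "u * (f b - f a + \<alpha> / 2 * (1 - u) * ?D)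
          \<le> f (proc_add (proc_scale (1 - u) a) (proc_scale u b)) - f a"
        using strongly_concaveD[OF f a b, of u] u by (simp add: algebra_simps)
      then show "f b - f a + \<alpha> / 2 * (1 - u) * ?D
          \<le> (f (proc_add (proc_scale (1 - u) a) (proc_scale u b)) - f a) / u"
        using u by (simp add: pos_le_divide_eq mult.commute)
    qed simp
  qed simp
  then show ?thesis by simp
qed

text \<open>Quadratic growth away from a constrained maximiser, obtained by comparing it with points
  of the segment that approach it.\<close>

lemma strongly_concave_le_at_arg_max:
  assumes f: "strongly_concave M F T \<alpha> f" and Ad: "Ad \<subseteq> proc_space M F T" "proc_convex Ad"
    and max: "is_arg_max f (\<lambda>b. b \<in> Ad) a" and b: "b \<in> Ad"
  shows "f b + \<alpha> / 2 * (proc_norm M T (proc_diff b a))\<^sup>2 \<le> f a"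
proof -
  have a: "a \<in> Ad" and le: "\<And>c. c \<in> Ad \<Longrightarrow> f c \<le> f a"
    using max by (auto simp: is_arg_max_linorder)
  have "\<alpha> / 2 * (proc_norm M T (proc_diff b a))\<^sup>2 \<le> f a - f b"
  \<comment> \<open>With weight \<open>z\<close> on \<open>a\<close>, cancelling
    \<open>1 - z\<close> leaves the claim with an extra factor \<open>z\<close>, which is removed by
    letting \<open>z\<close> tend to 1.\<close>
  proof (rule field_le_mult_one_interval)
    fix z :: real assume z: "0 < z" "z < 1"
    have "proc_add (proc_scale (1 - (1 - z)) a) (proc_scale (1 - z) b) \<in> Ad"
      by (rule proc_convexD[OF Ad(2) a b]) (use z in simp_all)
    then have "z * f a + (1 - z) * f b
        + \<alpha> / 2 * ((1 - z) * z) * (proc_norm M T (proc_diff b a))\<^sup>2 \<le> f a"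
      using strongly_concaveD[OF f, of a b "1 - z"] le a b z Ad(1) by (force simp: subset_iff)
    then have "(1 - z) * (z * (\<alpha> / 2 * (proc_norm M T (proc_diff b a))\<^sup>2)) \<le> (1 - z) * (f a - f b)"
      by (simp add: algebra_simps)
    then show "z * (\<alpha> / 2 * (proc_norm M T (proc_diff b a))\<^sup>2) \<le> f a - f b"
      using z by (simp add: mult_le_cancel_left)
  qed
  then show ?thesis by simp
qed

text \<open>The variational inequality: moving from a maximiser towards an admissible point never
  has positive slope.\<close>

lemma gradient_at_arg_max_le:
  assumes g: "has_gateaux_gradient M F T f g a" and Ad: "Ad \<subseteq> proc_space M F T" "proc_convex Ad"
    and max: "is_arg_max f (\<lambda>b. b \<in> Ad) a" and b: "b \<in> Ad"
  shows "proc_inner M T g (proc_diff b a) \<le> 0"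
proof (rule tendsto_upperbound[OF gateaux_gradient_right_limit[OF g]])
  have a: "a \<in> Ad" and le: "\<And>c. c \<in> Ad \<Longrightarrow> f c \<le> f a"
    using max by (auto simp: is_arg_max_linorder)
  show "a \<in> proc_space M F T" "b \<in> proc_space M F T" using a b Ad by auto
  show "\<forall>\<^sub>F u in at_right 0.
      (f (proc_add (proc_scale (1 - u) a) (proc_scale u b)) - f a) / u \<le> 0"
  proof (rule eventually_at_rightI)
    fix u :: real assume "u \<in> {0<..<1}"
    then show "(f (proc_add (proc_scale (1 - u) a) (proc_scale u b)) - f a) / u \<le> 0"
      using le Ad(2) a b by (simp add: proc_convex_def divide_le_0_iff)
  qed simp
qed simp

text \<open>Adding quadratic growth of \<open>f\<^sub>2\<close> at \<open>b\<close> to its tangent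
  bound at \<open>a\<close> gives \<alpha> |b - a|^2 \<le> <g2, b - a>. The variational inequality
  for \<open>f\<^sub>1\<close> allows subtracting <g1, b - a>, and Cauchy-Schwarz finishes. Both
  gradients are taken at the same point \<open>a\<close>, as the Lipschitz condition on the utility
  requires.\<close>

lemma arg_max_Lipschitz:
  assumes f\<^sub>1: "has_gateaux_gradient M F T f\<^sub>1 g\<^sub>1 a"
    and f\<^sub>2: "strongly_concave M F T \<alpha> f\<^sub>2" "has_gateaux_gradient M F T f\<^sub>2 g\<^sub>2 a"
    and Ad: "Ad \<subseteq> proc_space M F T" "proc_convex Ad"
    and a: "is_arg_max f\<^sub>1 (\<lambda>b. b \<in> Ad) a" and b: "is_arg_max f\<^sub>2 (\<lambda>b. b \<in> Ad) b"
  shows "\<alpha> * proc_norm M T (proc_diff a b) \<le> proc_norm M T (proc_diff g\<^sub>1 g\<^sub>2)"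
proof -
  let ?D = "proc_norm M T (proc_diff b a)"
  have ab: "a \<in> Ad" "b \<in> Ad" using a b by (auto simp: is_arg_max_def)
  then have [simp]: "a \<in> proc_space M F T" "b \<in> proc_space M F T" using Ad by auto
  have [simp]: "g\<^sub>1 \<in> proc_space M F T" "g\<^sub>2 \<in> proc_space M F T"
    using f\<^sub>1 f\<^sub>2 by (auto simp: has_gateaux_gradient_def)
  have "f\<^sub>2 a + \<alpha> / 2 * ?D\<^sup>2 \<le> f\<^sub>2 b"
    using strongly_concave_le_at_arg_max[OF f\<^sub>2(1) Ad b ab(1)]
    by (simp add: proc_norm_minus_commute[of a b])
  moreover have "f\<^sub>2 b + \<alpha> / 2 * ?D\<^sup>2 \<le> f\<^sub>2 a + proc_inner M T g\<^sub>2 (proc_diff b a)"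
    using strongly_concave_gradient_le[OF f\<^sub>2] by simp
  moreover have "proc_inner M T g\<^sub>1 (proc_diff b a) \<le> 0"
    using gradient_at_arg_max_le[OF f\<^sub>1 Ad a ab(2)] .
  moreover have "proc_inner M T (proc_diff g\<^sub>2 g\<^sub>1) (proc_diff b a)
      = proc_inner M T g\<^sub>2 (proc_diff b a) - proc_inner M T g\<^sub>1 (proc_diff b a)"
    by (rule proc_inner_diff_left) simp_all
  moreover have "\<bar>proc_inner M T (proc_diff g\<^sub>2 g\<^sub>1) (proc_diff b a)\<bar>
      \<le> proc_norm M T (proc_diff g\<^sub>2 g\<^sub>1) * ?D"
    by (rule proc_inner_abs_le) simp_all
  ultimately have "\<alpha> * ?D\<^sup>2 \<le> proc_norm M T (proc_diff g\<^sub>2 g\<^sub>1) * ?D" by linarith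
  then have "(\<alpha> * ?D) * ?D \<le> proc_norm M T (proc_diff g\<^sub>2 g\<^sub>1) * ?D"
    by (simp add: power2_eq_square mult.assoc)
  moreover have "0 \<le> ?D" "0 \<le> proc_norm M T (proc_diff g\<^sub>2 g\<^sub>1)" by (simp_all add: proc_norm_nonneg)
  ultimately have "\<alpha> * ?D \<le> proc_norm M T (proc_diff g\<^sub>2 g\<^sub>1)"
    by (cases "?D = 0") (auto simp: mult_le_cancel_right)
  then show ?thesis
    by (simp add: proc_norm_minus_commute[of a b] proc_norm_minus_commute[of g\<^sub>1 g\<^sub>2])
qed

text \<open>Strong concavity makes a maximising sequence Cauchy; its limit is a maximiser since \<open>f\<close> lies
  below its tangent at the limit.\<close>

lemma strongly_concave_arg_max_exists:
  assumes f: "strongly_concave M F T \<alpha> f"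
    and grad: "\<And>a. a \<in> proc_space M F T \<Longrightarrow> \<exists>g. has_gateaux_gradient M F T f g a"
    and Ad: "Ad \<subseteq> proc_space M F T" "Ad \<noteq> {}" "proc_convex Ad" "proc_closed M F T Ad"
  shows "\<exists>a. is_arg_max f (\<lambda>b. b \<in> Ad) a"
proof -
  have \<alpha>: "0 < \<alpha>" using f by (simp add: strongly_concave_def)
  obtain a\<^sub>0 where a\<^sub>0: "a\<^sub>0 \<in> Ad" using Ad by blast
  obtain g\<^sub>0 where g\<^sub>0: "has_gateaux_gradient M F T f g\<^sub>0 a\<^sub>0" using grad a\<^sub>0 Ad by blast
  have bdd: "bdd_above (f ` Ad)"
  proof (rule bdd_aboveI2)
    fix b assume "b \<in> Ad"
    then have b: "b \<in> proc_space M F T" using Ad by blast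
    let ?D = "proc_norm M T (proc_diff b a\<^sub>0)" and ?N = "proc_norm M T g\<^sub>0"
    have a\<^sub>0S: "a\<^sub>0 \<in> proc_space M F T" using a\<^sub>0 Ad by blast
    have "f b + \<alpha> / 2 * ?D\<^sup>2 \<le> f a\<^sub>0 + proc_inner M T g\<^sub>0 (proc_diff b a\<^sub>0)"
      by (rule strongly_concave_gradient_le[OF f g\<^sub>0 a\<^sub>0S b])
    moreover have "\<bar>proc_inner M T g\<^sub>0 (proc_diff b a\<^sub>0)\<bar> \<le> ?N * ?D"
      using g\<^sub>0 a\<^sub>0S b by (intro proc_inner_abs_le) (auto simp: has_gateaux_gradient_def)
    \<comment> \<open>Completing the square absorbs the linear tangent term into the quadratic
      margin, so the bound no longer depends on \<open>b\<close>.\<close>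
    moreover have "?N * ?D \<le> \<alpha> / 2 * ?D\<^sup>2 + ?N\<^sup>2 / (2 * \<alpha>)"
    proof -
      have "0 \<le> (\<alpha> * ?D - ?N)\<^sup>2 / (2 * \<alpha>)" using \<alpha> by simp
      also have "\<dots> = \<alpha> / 2 * ?D\<^sup>2 + ?N\<^sup>2 / (2 * \<alpha>) - ?N * ?D"
        using \<alpha> by (simp add: field_simps power2_eq_square)
      finally show ?thesis by simp
    qed
    ultimately show "f b \<le> f a\<^sub>0 + ?N\<^sup>2 / (2 * \<alpha>)" by linarith
  qed
  define s where "s = Sup (f ` Ad)"
  have le_s: "f b \<le> s" if "b \<in> Ad" for b
    unfolding s_def using bdd that by (intro cSup_upper) auto
  \<comment> \<open>The midpoint inequality bounds squared increments by a multiple of this slack;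
    its square root (1/2)^n is summable.\<close>
  have "\<exists>b\<in>Ad. s - (1 / 4) ^ n < f b" for n
    using less_cSup_iff[of "f ` Ad" "s - (1 / 4) ^ n"] bdd Ad(2) by (auto simp: s_def)
  then obtain a where a: "\<And>n. a n \<in> Ad" and near: "\<And>n. s - (1 / 4) ^ n < f (a n)"
    by metis
  have aS: "a n \<in> proc_space M F T" for n using a Ad by blast
  have "proc_norm M T (proc_diff (a (Suc n)) (a n)) \<le> sqrt (8 / \<alpha>) * (1 / 2) ^ n" for n
  proof (rule power2_le_imp_le)
    let ?D = "proc_norm M T (proc_diff (a (Suc n)) (a n))"
    have "proc_add (proc_scale (1 - 1 / 2) (a n)) (proc_scale (1 / 2) (a (Suc n))) \<in> Ad"
      by (rule proc_convexD[OF Ad(3) a a]) simp_all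
    then have "f (a n) / 2 + f (a (Suc n)) / 2 + \<alpha> / 8 * ?D\<^sup>2 \<le> s"
      using strongly_concaveD[OF f aS[of n] aS[of "Suc n"], of "1 / 2"] le_s
      by (auto intro: order.trans)
    moreover have "(1 / 4 :: real) ^ Suc n \<le> (1 / 4) ^ n" by simp
    ultimately have "\<alpha> / 8 * ?D\<^sup>2 \<le> (1 / 4) ^ n" using near[of n] near[of "Suc n"] by linarith
    then have "?D\<^sup>2 \<le> 8 / \<alpha> * (1 / 4) ^ n" using \<alpha> by (simp add: field_simps)
    also have "(1 / 4 :: real) ^ n = ((1 / 2) ^ n)\<^sup>2"
      by (simp add: power2_eq_square flip: power_mult_distrib)
    also have "8 / \<alpha> * ((1 / 2) ^ n)\<^sup>2 = (sqrt (8 / \<alpha>) * (1 / 2) ^ n)\<^sup>2"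
      using \<alpha> by (simp only: power_mult_distrib) simp
    finally show "?D\<^sup>2 \<le> (sqrt (8 / \<alpha>) * (1 / 2) ^ n)\<^sup>2" .
  qed (use \<alpha> in simp)
  moreover have "summable (\<lambda>n. sqrt (8 / \<alpha>) * (1 / 2) ^ n)"
    by (intro summable_mult summable_geometric) simp
  ultimately obtain l where l: "l \<in> proc_space M F T"
    and lim: "(\<lambda>n. proc_norm M T (proc_diff (a n) l)) \<longlonglongrightarrow> 0"
    by (rule proc_space_limit[OF aS])
  have "l \<in> Ad" using Ad(4) a l lim unfolding proc_closed_def by blast
  moreover have "s \<le> f l"
  proof -
    obtain g where g: "has_gateaux_gradient M F T f g l" using grad l by blast
    have "s - (1 / 4) ^ n \<le> f l + proc_norm M T g * proc_norm M T (proc_diff (a n) l)" for n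
    proof -
      have "f (a n) + \<alpha> / 2 * (proc_norm M T (proc_diff (a n) l))\<^sup>2
          \<le> f l + proc_inner M T g (proc_diff (a n) l)"
        by (rule strongly_concave_gradient_le[OF f g l aS])
      moreover have "0 \<le> \<alpha> / 2 * (proc_norm M T (proc_diff (a n) l))\<^sup>2" using \<alpha> by simp
      moreover have "\<bar>proc_inner M T g (proc_diff (a n) l)\<bar>
          \<le> proc_norm M T g * proc_norm M T (proc_diff (a n) l)"
        using g l aS by (intro proc_inner_abs_le) (auto simp: has_gateaux_gradient_def)
      ultimately show ?thesis using near[of n] by linarith
    qed
    moreover have "(\<lambda>n. s - (1 / 4) ^ n) \<longlonglongrightarrow> s - 0"
      by (intro tendsto_intros LIMSEQ_power_zero) simp
    moreover have "(\<lambda>n. f l + proc_norm M T g * proc_norm M T (proc_diff (a n) l))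
        \<longlonglongrightarrow> f l + proc_norm M T g * 0"
      by (intro tendsto_intros lim)
    ultimately have "s - 0 \<le> f l + proc_norm M T g * 0"
      by (intro LIMSEQ_le) auto
    then show ?thesis by simp
  qed
  ultimately show ?thesis using le_s unfolding is_arg_max_linorder by (meson order.trans)
qed

subsection \<open>Nash equilibria\<close>

text \<open>The Euclidean norm over players is the one in which \<open>largest_eigenvalue G\<close>
  bounds the action of \<open>G\<close>.\<close>

definition profile_dist :: "('n::finite \<Rightarrow> 'w process) \<Rightarrow> ('n \<Rightarrow> 'w process) \<Rightarrow> real" where
  "profile_dist a b = norm (\<chi> i. proc_norm M T (proc_diff (a i) (b i)))"

lemma profile_dist_nonneg: "0 \<le> profile_dist a b"
  by (simp add: profile_dist_def)

lemma proc_norm_le_profile_dist: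
  "proc_norm M T (proc_diff (a i) (b i)) \<le> profile_dist a b"
  using component_le_norm_cart[of "\<chi> i. proc_norm M T (proc_diff (a i) (b i))" i]
  by (simp add: profile_dist_def)

lemma profile_dist_triangle:
  assumes "\<And>i. a i \<in> proc_space M F T" "\<And>i. b i \<in> proc_space M F T" "\<And>i. c i \<in> proc_space M F T"
  shows "profile_dist a c \<le> profile_dist a b + profile_dist b c"
proof -
  have "profile_dist a c \<le> norm ((\<chi> i. proc_norm M T (proc_diff (a i) (b i)))
      + (\<chi> i. proc_norm M T (proc_diff (b i) (c i))))"
    unfolding profile_dist_def
  proof (rule norm_le_componentwise_cart)
    fix i
    show "norm ((\<chi> i. proc_norm M T (proc_diff (a i) (c i))) $ i)
        \<le> norm (((\<chi> i. proc_norm M T (proc_diff (a i) (b i)))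
          + (\<chi> i. proc_norm M T (proc_diff (b i) (c i)))) $ i)"
      using proc_norm_triangle[OF assms(1,2,3), of i i i] assms
      by (simp add: proc_norm_nonneg)
  qed
  also have "\<dots> \<le> profile_dist a b + profile_dist b c"
    unfolding profile_dist_def by (rule norm_triangle_ineq)
  finally show ?thesis .
qed

lemma profile_dist_commute:
  assumes "\<And>i. a i \<in> proc_space M F T" "\<And>i. b i \<in> proc_space M F T"
  shows "profile_dist a b = profile_dist b a"
  using assms by (simp add: profile_dist_def proc_norm_minus_commute[of "a _"])

text \<open>Banach iteration, with limits taken player by player and kept admissible by closedness.
  Since points are representatives, the fixed point is obtained up to distance zero rather than as
  an equation.\<close>

lemma profile_contraction_fixed_point:
  fixes \<Phi> :: "('n::finite \<Rightarrow> 'w process) \<Rightarrow> 'n \<Rightarrow> 'w process"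
  assumes Ad: "\<And>i. Ad i \<subseteq> proc_space M F T" "\<And>i. Ad i \<noteq> {}" "\<And>i. proc_closed M F T (Ad i)"
    and maps: "\<And>a i. (\<And>j. a j \<in> Ad j) \<Longrightarrow> \<Phi> a i \<in> Ad i"
    and contr: "\<And>a b. (\<And>j. a j \<in> Ad j) \<Longrightarrow> (\<And>j. b j \<in> Ad j) \<Longrightarrow>
        profile_dist (\<Phi> a) (\<Phi> b) \<le> q * profile_dist a b"
    and q: "0 \<le> q" "q < 1"
  obtains l where "\<And>i. l i \<in> Ad i" "profile_dist (\<Phi> l) l = 0"
proof -
  have "\<exists>c. \<forall>i. c i \<in> Ad i" using Ad(2) by (intro choice) blast
  then obtain c where c: "\<And>i. c i \<in> Ad i" by blast
  define a where "a n = (\<Phi> ^^ n) c" for n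
  have a_Suc: "a (Suc n) = \<Phi> (a n)" for n by (simp add: a_def)
  have a: "a n i \<in> Ad i" for n i
    by (induction n arbitrary: i) (simp_all add: a_def c maps)
  have aS: "a n i \<in> proc_space M F T" for n i using a Ad(1) by blast
  have dist: "profile_dist (a (Suc n)) (a n) \<le> profile_dist (a 1) (a 0) * q ^ n" for n
  proof (induction n)
    case (Suc n)
    have "profile_dist (a (Suc (Suc n))) (a (Suc n)) \<le> q * profile_dist (a (Suc n)) (a n)"
      unfolding a_Suc[of "Suc n"] a_Suc[of n] by (intro contr maps a)
    also have "\<dots> \<le> q * (profile_dist (a 1) (a 0) * q ^ n)"
      using Suc.IH q(1) by (rule mult_left_mono)
    finally show ?case by (simp add: mult_ac)
  qed simp
  have summ: "summable (\<lambda>n. profile_dist (a 1) (a 0) * q ^ n)"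
    using q by (intro summable_mult summable_geometric) simp
  have "\<exists>x. x \<in> proc_space M F T \<and> (\<lambda>n. proc_norm M T (proc_diff (a n i) x)) \<longlonglongrightarrow> 0" for i
  proof -
    have "proc_norm M T (proc_diff (a (Suc n) i) (a n i)) \<le> profile_dist (a 1) (a 0) * q ^ n" for n
      by (rule order.trans[OF proc_norm_le_profile_dist dist])
    from proc_space_limit[where a="\<lambda>n. a n i", OF aS this summ] show ?thesis by blast
  qed
  then have "\<exists>l. \<forall>i. l i \<in> proc_space M F T \<and> (\<lambda>n. proc_norm M T (proc_diff (a n i) (l i))) \<longlonglongrightarrow> 0"
    by (intro choice) blast
  then obtain l where lS: "\<And>i. l i \<in> proc_space M F T"
    and lim: "\<And>i. (\<lambda>n. proc_norm M T (proc_diff (a n i) (l i))) \<longlonglongrightarrow> 0"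
    by blast
  have l: "l i \<in> Ad i" for i
    using Ad(3)[of i, unfolded proc_closed_def, rule_format, of "\<lambda>n. a n i" "l i"] a lS lim
    by simp
  have \<Phi>S: "\<Phi> l i \<in> proc_space M F T" for i using maps[OF l] Ad(1) by blast
  have lim_dist: "(\<lambda>n. profile_dist (a n) l) \<longlonglongrightarrow> 0"
    unfolding profile_dist_def
    by (rule tendsto_norm_zero, rule vec_tendstoI) (simp add: lim)
  \<comment> \<open>Inserting the next iterate, which is the image of \<open>a n\<close>, leaves two
    terms that both tend to 0.\<close>
  have "profile_dist (\<Phi> l) l \<le> q * profile_dist (a n) l + profile_dist (a (Suc n)) l" for n
  proof -
    have "profile_dist (\<Phi> l) l \<le> profile_dist (\<Phi> l) (a (Suc n)) + profile_dist (a (Suc n)) l"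
      by (intro profile_dist_triangle \<Phi>S aS lS)
    moreover have "profile_dist (\<Phi> l) (a (Suc n)) \<le> q * profile_dist l (a n)"
      unfolding a_Suc by (intro contr l a)
    moreover have "profile_dist l (a n) = profile_dist (a n) l"
      by (intro profile_dist_commute aS lS)
    ultimately show ?thesis by simp
  qed
  moreover have "(\<lambda>n. q * profile_dist (a n) l + profile_dist (a (Suc n)) l) \<longlonglongrightarrow> q * 0 + 0"
    by (intro tendsto_intros lim_dist LIMSEQ_Suc[OF lim_dist])
  ultimately have "profile_dist (\<Phi> l) l \<le> 0"
    by (intro LIMSEQ_le_const) auto
  then have "profile_dist (\<Phi> l) l = 0" using profile_dist_nonneg[of "\<Phi> l" l] by simp
  with l show thesis by (rule that)
qed

section \<open>Local aggregates and contraction of best replies\<close>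

lemma local_aggregate_in:
  assumes "\<And>j. a j \<in> proc_space M F T"
  shows "local_aggregate G a i \<in> proc_space M F T"
proof -
  have "local_aggregate G a i
      = proc_scale (1 / real CARD('a)) (\<lambda>w t. \<Sum>j\<in>UNIV. proc_scale (G $ i $ j) (a j) w t)"
    by (simp add: local_aggregate_def proc_scale_def)
  then show ?thesis using assms by simp
qed

text \<open>Triangle inequality; nonnegative entries come out of the norm unchanged, so the bound
  involves \<open>G\<close> itself.\<close>

lemma local_aggregate_diff_le:
  fixes G :: "real^'n^'n"
  assumes G: "\<And>i j. 0 \<le> G $ i $ j"
    and a: "\<And>j. a j \<in> proc_space M F T" and b: "\<And>j. b j \<in> proc_space M F T"
  shows "proc_norm M T (proc_diff (local_aggregate G a i) (local_aggregate G b i))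
    \<le> (G *v (\<chi> j. proc_norm M T (proc_diff (a j) (b j)))) $ i / real CARD('n)"
proof -
  let ?S = "\<lambda>w t. \<Sum>j\<in>UNIV. proc_scale (G $ i $ j) (proc_diff (a j) (b j)) w t"
  have "proc_diff (local_aggregate G a i) (local_aggregate G b i)
      = proc_scale (1 / real CARD('n)) ?S"
    by (simp add: local_aggregate_def proc_scale_def proc_diff_def right_diff_distrib
        sum_subtractf diff_divide_distrib)
  moreover have "proc_norm M T ?S \<le> (\<Sum>j\<in>UNIV. proc_norm M T (proc_scale (G $ i $ j) (proc_diff (a j) (b j))))"
    using a b by (intro proc_norm_sum_le) auto
  ultimately show ?thesis
    using a b G by (simp add: proc_norm_scale matrix_vector_mult_def divide_right_mono)
qed

text \<open>Within one game the heterogeneity processes are fixed, so the Lipschitz condition is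
  stated for varying aggregates, and \<open>0 \<le> l\<close> is supplied separately.\<close>

lemma unique_nash_equilibrium_if_contractive:
  fixes U :: "'w process \<Rightarrow> 'w process \<Rightarrow> 'w process \<Rightarrow> real" and G :: "real^'n^'n"
  assumes U: "utility_functional M F T U"
    and \<theta>: "\<And>i. \<theta> i \<in> proc_space M F T"
    and differentiable: "\<And>z \<eta>. z \<in> proc_space M F T \<Longrightarrow> \<eta> \<in> proc_space M F T \<Longrightarrow>
          continuously_gateaux_differentiable M F T (\<lambda>a. U a z \<eta>)"
    and \<alpha>: "0 < \<alpha>" and concave: "\<And>z \<eta>. z \<in> proc_space M F T \<Longrightarrow> \<eta> \<in> proc_space M F T \<Longrightarrow>
          strongly_concave M F T \<alpha> (\<lambda>a. U a z \<eta>)"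
    and Lipschitz: "\<And>a z\<^sub>1 z\<^sub>2 \<eta>. a \<in> proc_space M F T \<Longrightarrow>
          z\<^sub>1 \<in> proc_space M F T \<Longrightarrow> z\<^sub>2 \<in> proc_space M F T \<Longrightarrow> \<eta> \<in> proc_space M F T \<Longrightarrow>
          proc_norm M T (proc_diff (gateaux_gradient M F T (\<lambda>b. U b z\<^sub>1 \<eta>) a)
                                   (gateaux_gradient M F T (\<lambda>b. U b z\<^sub>2 \<eta>) a))
            \<le> l * proc_norm M T (proc_diff z\<^sub>1 z\<^sub>2)"
    and l: "0 \<le> l"
    and Ad: "\<And>i. Ad i \<subseteq> proc_space M F T" "\<And>i. Ad i \<noteq> {}"
          "\<And>i. proc_convex (Ad i)" "\<And>i. proc_closed M F T (Ad i)"
    and G: "symmetric_adjacency G"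
    and small: "l * largest_eigenvalue G < \<alpha> * real CARD('n)"
  shows "unique_nash_equilibrium M T Ad U \<theta> G"
proof -
  define q where "q = l * largest_eigenvalue G / (\<alpha> * real CARD('n))"
  have N: "0 < real CARD('n)" by simp
  have q: "0 \<le> q" "q < 1"
    using \<alpha> N l small symmetric_adjacency_norm_le(2)[OF G] by (simp_all add: q_def)
  have Gnn: "0 \<le> G $ i $ j" for i j using G by (auto simp: symmetric_adjacency_def)
  have grad: "has_gateaux_gradient M F T (\<lambda>b. U b z \<eta>) (gateaux_gradient M F T (\<lambda>b. U b z \<eta>) a) a"
    if "a \<in> proc_space M F T" "z \<in> proc_space M F T" "\<eta> \<in> proc_space M F T" for a z \<eta>
  proof -
    have "\<exists>g. has_gateaux_gradient M F T (\<lambda>b. U b z \<eta>) g a"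
      using differentiable[OF that(2,3)] that(1)
      unfolding continuously_gateaux_differentiable_def by blast
    then show ?thesis unfolding gateaux_gradient_def by (rule someI_ex)
  qed
  have AdS: "a i \<in> proc_space M F T" if "\<And>j. a j \<in> Ad j" for a i
    using that Ad(1) by blast
  let ?best = "\<lambda>x i. is_arg_max (\<lambda>b. U b (local_aggregate G x i) (\<theta> i)) (\<lambda>b. b \<in> Ad i)"
  \<comment> \<open>Stated for arbitrary best replies instead of a chosen map, so that it serves
    both the iteration and the comparison of two equilibria.\<close>
  have contr: "profile_dist a b \<le> q * profile_dist x y"
    if x: "\<And>j. x j \<in> Ad j" and y: "\<And>j. y j \<in> Ad j"
      and a: "\<And>i. ?best x i (a i)" and b: "\<And>i. ?best y i (b i)" for a b x y
  proof -
    let ?d = "\<chi> j. proc_norm M T (proc_diff (x j) (y j))"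
    have comp: "proc_norm M T (proc_diff (a i) (b i)) \<le> l / (\<alpha> * real CARD('n)) * (G *v ?d) $ i"
      for i
    proof -
      let ?x = "local_aggregate G x i" and ?y = "local_aggregate G y i"
      have zS: "?x \<in> proc_space M F T" "?y \<in> proc_space M F T"
        by (intro local_aggregate_in AdS x y)+
      have aS: "a i \<in> proc_space M F T" using a[of i] Ad(1) by (auto simp: is_arg_max_def)
      have "\<alpha> * proc_norm M T (proc_diff (a i) (b i))
          \<le> proc_norm M T (proc_diff (gateaux_gradient M F T (\<lambda>b. U b ?x (\<theta> i)) (a i))
              (gateaux_gradient M F T (\<lambda>b. U b ?y (\<theta> i)) (a i)))"
        by (rule arg_max_Lipschitz[OF grad[OF aS zS(1) \<theta>] concave[OF zS(2) \<theta>]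
              grad[OF aS zS(2) \<theta>] Ad(1,3) a b])
      also have "\<dots> \<le> l * proc_norm M T (proc_diff ?x ?y)"
        by (rule Lipschitz[OF aS zS \<theta>])
      also have "\<dots> \<le> l * ((G *v ?d) $ i / real CARD('n))"
        using local_aggregate_diff_le[OF Gnn, of x y i] AdS[OF x] AdS[OF y] l
        by (intro mult_left_mono) auto
      finally show ?thesis using \<alpha> N by (simp add: field_simps)
    qed
    \<comment> \<open>Entrywise domination passes to Euclidean norms, where the eigenvalue bound for
      \<open>G\<close> applies.\<close>
    have "profile_dist a b \<le> norm ((l / (\<alpha> * real CARD('n))) *\<^sub>R (G *v ?d))"
      unfolding profile_dist_def
    proof (rule norm_le_componentwise_cart)
      fix i
      have "a i \<in> proc_space M F T" "b i \<in> proc_space M F T"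
        using a[of i] b[of i] Ad(1) by (auto simp: is_arg_max_def)
      then show "norm ((\<chi> i. proc_norm M T (proc_diff (a i) (b i))) $ i)
          \<le> norm (((l / (\<alpha> * real CARD('n))) *\<^sub>R (G *v ?d)) $ i)"
        using order.trans[OF comp abs_ge_self, of i] by (simp add: proc_norm_nonneg)
    qed
    also have "\<dots> = l / (\<alpha> * real CARD('n)) * norm (G *v ?d)"
      using l \<alpha> by simp
    also have "\<dots> \<le> l / (\<alpha> * real CARD('n)) * (largest_eigenvalue G * norm ?d)"
      using l \<alpha> by (intro mult_left_mono symmetric_adjacency_norm_le(1)[OF G]) simp
    finally show ?thesis by (simp add: q_def profile_dist_def)
  qed
  define \<Phi> where "\<Phi> x i = (SOME b. ?best x i b)" for x i
  have best: "?best x i (\<Phi> x i)" if x: "\<And>j. x j \<in> Ad j" for x i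
  proof -
    have z: "local_aggregate G x i \<in> proc_space M F T"
      by (intro local_aggregate_in AdS x)
    have "\<exists>b. ?best x i b"
      by (rule strongly_concave_arg_max_exists[OF concave[OF z \<theta>] _ Ad])
        (use grad z \<theta> in blast)
    then show ?thesis unfolding \<Phi>_def by (rule someI_ex)
  qed
  have maps: "\<Phi> x i \<in> Ad i" if "\<And>j. x j \<in> Ad j" for x i
    using best[OF that] by (simp add: is_arg_max_def)
  have contr_\<Phi>: "profile_dist (\<Phi> x) (\<Phi> y) \<le> q * profile_dist x y"
    if "\<And>j. x j \<in> Ad j" "\<And>j. y j \<in> Ad j" for x y
    by (rule contr[OF that best best]) (fact that)+
  obtain a where a: "\<And>i. a i \<in> Ad i" and fixed: "profile_dist (\<Phi> a) a = 0"
    using profile_contraction_fixed_point[OF Ad(1,2,4) maps contr_\<Phi> q] by metis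
  have eq_if_dist_0: "proc_eq M T (x i) (y i)"
    if "profile_dist x y = 0" "\<And>j. x j \<in> Ad j" "\<And>j. y j \<in> Ad j" for x y i
    using proc_norm_le_profile_dist[of x i y] that proc_norm_nonneg[of "proc_diff (x i) (y i)"]
      AdS[OF that(2)] AdS[OF that(3)]
    by (intro proc_eq_if_norm_zero) (auto intro: order.antisym)
  have nash: "nash_equilibrium Ad U \<theta> G a"
    unfolding nash_equilibrium_def
  proof
    fix i
    have z: "local_aggregate G a i \<in> proc_space M F T"
      by (intro local_aggregate_in AdS a)
    have refl: "proc_eq M T x x" for x by (simp add: proc_eq_def)
    have "proc_eq M T (\<Phi> a i) (a i)"
      by (rule eq_if_dist_0[OF fixed maps a]) (rule a)
    \<comment> \<open>The fixed point holds only up to \<open>proc_eq\<close>; as \<open>U\<close>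
      ignores representatives, \<open>a i\<close> attains the same maximal value as the chosen best
      reply.\<close>
    then have "U (\<Phi> a i) (local_aggregate G a i) (\<theta> i) = U (a i) (local_aggregate G a i) (\<theta> i)"
      using U z \<theta> AdS[OF a] AdS[OF maps, OF a] refl unfolding utility_functional_def by blast
    then show "?best a i (a i)"
      using best[OF a, of i] a by (simp add: is_arg_max_def)
  qed
  moreover have "proc_eq M T (b i) (a i)" if "nash_equilibrium Ad U \<theta> G b" for b i
  proof -
    have ne: "\<And>i. ?best b i (b i)" "\<And>i. ?best a i (a i)"
      using that nash by (auto simp: nash_equilibrium_def)
    have b: "b i \<in> Ad i" for i using ne(1) by (simp add: is_arg_max_def)
    \<comment> \<open>Each equilibrium is a best reply to itself, so their distance shrinks under a
      factor below 1 and must vanish.\<close>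
    have "profile_dist b a \<le> q * profile_dist b a"
      by (rule contr[OF b a ne])
    then have "(1 - q) * profile_dist b a \<le> 0" by (simp add: algebra_simps)
    then have "profile_dist b a = 0"
      using q profile_dist_nonneg[of b a] by (simp add: mult_le_0_iff)
    then show ?thesis using b a by (rule eq_if_dist_0)
  qed
  ultimately show ?thesis unfolding unique_nash_equilibrium_def by blast
qed

text \<open>\<open>M\<close> has total mass 1 and the time interval has length \<open>T\<close>;
  positivity of \<open>T\<close> then makes nonzero constants have positive norm.\<close>

lemma proc_norm_const: "proc_norm M T (\<lambda>w t. c) = sqrt T * \<bar>c\<bar>"
  using horizon_pos
  by (simp add: proc_norm_def set_lebesgue_integral_def prob_space real_sqrt_mult)

end

theorem corollary2p11:
  fixes M :: "'w measure" and F :: "real \<Rightarrow> 'w measure" and T :: real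
    and U :: "'w process \<Rightarrow> 'w process \<Rightarrow> 'w process \<Rightarrow> real"
    and \<theta> :: "'n::finite \<Rightarrow> 'w process"
    and Ad :: "'n \<Rightarrow> 'w process set"
    and \<alpha>\<^sub>U l\<^sub>U l\<^sub>\<theta> :: real
  assumes "filtered_prob_space M F T"
    and "utility_functional M F T U"
    and "\<And>i. \<theta> i \<in> proc_space M F T"
    and A1_differentiable: "\<And>z \<eta>. z \<in> proc_space M F T \<Longrightarrow> \<eta> \<in> proc_space M F T \<Longrightarrow>
          continuously_gateaux_differentiable M F T (\<lambda>a. U a z \<eta>)"
    and A1_concave: "0 < \<alpha>\<^sub>U"
          "\<And>z \<eta>. z \<in> proc_space M F T \<Longrightarrow> \<eta> \<in> proc_space M F T \<Longrightarrow>
          strongly_concave M F T \<alpha>\<^sub>U (\<lambda>a. U a z \<eta>)"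
    and A1_Lipschitz: "\<And>a z\<^sub>1 z\<^sub>2 \<eta>\<^sub>1 \<eta>\<^sub>2.
          a \<in> proc_space M F T \<Longrightarrow>
          z\<^sub>1 \<in> proc_space M F T \<Longrightarrow> z\<^sub>2 \<in> proc_space M F T \<Longrightarrow>
          \<eta>\<^sub>1 \<in> proc_space M F T \<Longrightarrow> \<eta>\<^sub>2 \<in> proc_space M F T \<Longrightarrow>
          proc_norm M T (proc_diff (gateaux_gradient M F T (\<lambda>b. U b z\<^sub>1 \<eta>\<^sub>1) a)
                                   (gateaux_gradient M F T (\<lambda>b. U b z\<^sub>2 \<eta>\<^sub>2) a))
            \<le> l\<^sub>U * proc_norm M T (proc_diff z\<^sub>1 z\<^sub>2) + l\<^sub>\<theta> * proc_norm M T (proc_diff \<eta>\<^sub>1 \<eta>\<^sub>2)"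
    and A2: "\<And>i. Ad i \<subseteq> proc_space M F T" "\<And>i. Ad i \<noteq> {}"
          "\<And>i. proc_convex (Ad i)" "\<And>i. proc_closed M F T (Ad i)"
  shows "(\<forall>G :: real^'n^'n. symmetric_adjacency G \<longrightarrow>
            l\<^sub>U * largest_eigenvalue G < \<alpha>\<^sub>U * real CARD('n) \<longrightarrow>
            unique_nash_equilibrium M T Ad U \<theta> G)
       \<and> (l\<^sub>U < \<alpha>\<^sub>U \<longrightarrow>
            (\<forall>G :: real^'n^'n. symmetric_adjacency G \<longrightarrow>
               unique_nash_equilibrium M T Ad U \<theta> G))"
proof -
  interpret filtered_prob_space M F T by fact
  have grad_in: "gateaux_gradient M F T (\<lambda>b. U b z \<eta>) a \<in> proc_space M F T"
    if "a \<in> proc_space M F T" "z \<in> proc_space M F T" "\<eta> \<in> proc_space M F T" for a z \<eta>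
  proof -
    have "\<exists>g. has_gateaux_gradient M F T (\<lambda>b. U b z \<eta>) g a"
      using A1_differentiable[OF that(2,3)] that(1)
      unfolding continuously_gateaux_differentiable_def by blast
    then show ?thesis
      unfolding gateaux_gradient_def by (rule someI2_ex) (simp add: has_gateaux_gradient_def)
  qed
  have Lipschitz: "proc_norm M T (proc_diff (gateaux_gradient M F T (\<lambda>b. U b z\<^sub>1 \<eta>) a)
        (gateaux_gradient M F T (\<lambda>b. U b z\<^sub>2 \<eta>) a)) \<le> l\<^sub>U * proc_norm M T (proc_diff z\<^sub>1 z\<^sub>2)"
    if "a \<in> proc_space M F T" "z\<^sub>1 \<in> proc_space M F T" "z\<^sub>2 \<in> proc_space M F T"
      "\<eta> \<in> proc_space M F T" for a z\<^sub>1 z\<^sub>2 \<eta>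
    \<comment> \<open>Equal heterogeneity processes differ by the zero constant, so the \<theta>
      term vanishes.\<close>
    using A1_Lipschitz[OF that(1,2,3,4,4)] by (simp add: proc_diff_def proc_norm_const)
  \<comment> \<open>The Lipschitz bound at the constant aggregates 1 and 0 has a nonnegative left
    side, and their distance is the positive number \<open>sqrt T\<close>; this fixes the sign of
    \<open>l\<^sub>U\<close>.\<close>
  have "0 \<le> l\<^sub>U * proc_norm M T (proc_diff (\<lambda>w t. 1) (\<lambda>w t. 0))"
    by (rule order.trans[OF proc_norm_nonneg
          Lipschitz[OF proc_const_in[of 0] proc_const_in[of 1] proc_const_in[of 0] proc_const_in[of 0]]])
      (intro proc_diff_in grad_in proc_const_in)
  then have "0 \<le> l\<^sub>U * sqrt T" by (simp add: proc_diff_def proc_norm_const)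
  then have l: "0 \<le> l\<^sub>U" using horizon_pos by (simp add: zero_le_mult_iff)
  have unique: "unique_nash_equilibrium M T Ad U \<theta> G"
    if "symmetric_adjacency G" "l\<^sub>U * largest_eigenvalue G < \<alpha>\<^sub>U * real CARD('n)"
    for G :: "real^'n^'n"
    by (rule unique_nash_equilibrium_if_contractive[OF assms(2,3) A1_differentiable A1_concave
          Lipschitz l A2 that])
  moreover have "l\<^sub>U * largest_eigenvalue G < \<alpha>\<^sub>U * real CARD('n)"
    if "l\<^sub>U < \<alpha>\<^sub>U" "symmetric_adjacency G" for G :: "real^'n^'n"
  proof -
    have "l\<^sub>U * largest_eigenvalue G \<le> l\<^sub>U * real CARD('n)"
      using symmetric_adjacency_norm_le(3)[OF that(2)] l by (rule mult_left_mono)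
    also have "\<dots> < \<alpha>\<^sub>U * real CARD('n)" using that(1) by simp
    finally show ?thesis .
  qed
  ultimately show ?thesis by blast
qed

end
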